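(* Let $0<\varrho\le 1$ and $0\le u\le 1/2$. Then \begin{align*} \text{(L)}\quad & C(u,u;\varrho)\ \ge\ u\cdot g(u;\varrho)\cdot\left(1+\frac{2}{\pi}\arcsin(\varrho)\right),\\ \text{(U)}\quad & C(u,u;\varrho)\ \le\ u\cdot g(u;\varrho)\cdot(1+\varrho). \end{align*} These bounds are the optimal ones of the form $u\cdot g(u;\varrho)\cdot a(\varrho)$; that is, for each fixed $\varrho$: if $a\in\mathbb{R}$ satisfies $C(u,u;\varrho)\ge u\,g(u;\varrho)\,a$ for all $u\in[0,1/2]$, then $a\le 1+\frac{2}{\pi}\arcsin(\varrho)$; and if $a\in\mathbb{R}$ satisfies $C(u,u;\varrho)\le u\,g(u;\varrho)\,a$ for all $u\in[0,1/2]$, then $a\ge 1+\varrho$. Both bounds are tight (i.e. hold with equality) for $\varrho=0$ (where the same expressions are considered with $\varrho=0$), for $\varrho=1$, or for $u=0$. The maximum over $\varrho$ and $u\in[0,1/2]$ of the error $u\,g(u;\varrho)(1+\varrho)-C(u,u;\varrho)$ of (U) is attained for $u=1/2$, $\varrho=\sqrt{1-\frac{4}{\pi^2}}\approx 0.7712$, its value being $$\frac14\left(\sqrt{1-\frac{4}{\pi^2}}-\frac{2}{\pi}\arcsin\left(\sqrt{1-\frac{4}{\pi^2}}\right)\right)\approx 0.05263.$$ The lower bound (L) is tight (holds with equality) for $u=1/2$.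
   Context: $\Phi$ is the standard normal distribution function. For $\varrho\in(-1,1)$, $$\varphi_2(x,y;\varrho)=\frac{1}{2\pi\sqrt{1-\varrho^2}}\exp\left(-\frac{x^2-2\varrho xy+y^2}{2(1-\varrho^2)}\right),\qquad \Phi_2(h,k;\varrho)=\int_{-\infty}^h\int_{-\infty}^k\varphi_2(x,y;\varrho)\,dy\,dx,$$ and the bivariate normal copula is $C(u,v;\varrho)=\Phi_2(\Phi^{-1}(u),\Phi^{-1}(v);\varrho)$ for $u,v\in(0,1)$, extended continuously to $[0,1]^2$ (so $C(0,v;\varrho)=C(u,0;\varrho)=0$). For $\varrho=1$ it is defined by the limit $\varrho\to1$: $C(u,v;1)=\min(u,v)$. For $\varrho\in(-1,1]$ and $u\in(0,1)$, $$g(u;\varrho):=\Phi\left(\sqrt{\frac{1-\varrho}{1+\varrho}}\cdot\Phi^{-1}(u)\right).$$ At $u=0$, $g(0;\varrho)$ is the limit $u\to0^+$ of $g(u;\varrho)$ (it equals $0$ for $\varrho<1$); in any case $u\cdot g(u;\varrho)$ is $0$ at $u=0$. *)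

theory Defs
  imports "HOL-Probability.Probability"
begin

definition std_normal_cdf :: "real \<Rightarrow> real" where
  "std_normal_cdf = cdf std_normal_distribution"

(* std_normal_cdf is a bijection from the reals onto {0<..<1}; the quantile function is only
   meaningful on that interval. *)
definition std_normal_quantile :: "real \<Rightarrow> real" where
  "std_normal_quantile = inv std_normal_cdf"

definition bvn_density :: "real \<Rightarrow> real \<Rightarrow> real \<Rightarrow> real" where
  "bvn_density x y \<rho> =
     1 / (2 * pi * sqrt (1 - \<rho>\<^sup>2)) * exp (- (x\<^sup>2 - 2 * \<rho> * x * y + y\<^sup>2) / (2 * (1 - \<rho>\<^sup>2)))"

definition bvn_cdf :: "real \<Rightarrow> real \<Rightarrow> real \<Rightarrow> real" where
  "bvn_cdf h k \<rho> = (LBINT x:{..h}. (LBINT y:{..k}. bvn_density x y \<rho>))"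

definition bvn_copula_interior :: "real \<Rightarrow> real \<Rightarrow> real \<Rightarrow> real" where
  "bvn_copula_interior u v \<rho> = bvn_cdf (std_normal_quantile u) (std_normal_quantile v) \<rho>"

(* Copula on the closed unit square for -1 < \<rho> < 1: the continuous extension of the formula
   on the open square, so that it is 0 if u = 0 or v = 0. *)
definition bvn_copula_closed :: "real \<Rightarrow> real \<Rightarrow> real \<Rightarrow> real" where
  "bvn_copula_closed u v \<rho> =
     (if u \<in> {0<..<1} \<and> v \<in> {0<..<1} then bvn_copula_interior u v \<rho>
      else Lim (at (u, v) within {0<..<1} \<times> {0<..<1}) (\<lambda>(s, t). bvn_copula_interior s t \<rho>))"

(* The value at \<rho> = 1 is the limit from below, which equals min u v. *)
definition bvn_copula :: "real \<Rightarrow> real \<Rightarrow> real \<Rightarrow> real" where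
  "bvn_copula u v \<rho> =
     (if \<rho> = 1 then Lim (at_left 1) (\<lambda>r. bvn_copula_closed u v r)
      else bvn_copula_closed u v \<rho>)"

definition bvn_g_interior :: "real \<Rightarrow> real \<Rightarrow> real" where
  "bvn_g_interior u \<rho> = std_normal_cdf (sqrt ((1 - \<rho>) / (1 + \<rho>)) * std_normal_quantile u)"

(* The value at u = 0 is the limit from the right: 0 for \<rho> < 1 and 1/2 for \<rho> = 1. *)
definition bvn_g :: "real \<Rightarrow> real \<Rightarrow> real" where
  "bvn_g u \<rho> =
     (if u = 0 then Lim (at_right 0) (\<lambda>t. bvn_g_interior t \<rho>) else bvn_g_interior u \<rho>)"

end

(* Write h for the quantile of u in (0, 1/2] and l for sqrt ((1 - rho) / (1 + rho)). By symmetry of the density,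
   C(u,u) is the integral over (-inf, h] of 2 phi(t) Phi(l t), while u g(u) = Phi(h) Phi(l h).
   The quotient of the derivatives of u g(u) and C(u,u) with respect to h is
   (1 + l m(h) / m(l h)) / 2 with m = Phi / phi. It increases on (-inf, 0], starting from the limit
   1 / (1 + rho) at -inf. Hence u g(u) / C(u,u) increases as well (monotone l'Hopital rule); its
   limit at -inf gives (U) and its value at h = 0, where C is a wedge probability, gives (L).
   The case rho = 1 is the limit of these bounds, which coincide there. *)
theory Submission
  imports Defs "HOL-Real_Asymp.Real_Asymp"
begin

subsection \<open>Calculus of the normal distribution function\<close>

text \<open>The step that needs work is the growth of m(h) / m(l h). Its logarithmic derivative
  times h is E(h) - E(l h), where E(t) = t m'(t) / m(t) = t / m(t) + t^2; as h <= l h for h <= 0, it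
  is enough that E increases. Now E is again a quotient of functions vanishing at -inf, namely (t
  phi + t^2 Phi) / Phi, with derivative quotient 1 + 2 t m(t). So the monotone rule is used a second
  time, and everything comes down to the growth of t m(t), that is, to (1 + t^2) Phi(t) + t phi(t)
  >= 0. This expression is twice the second iterated integral of Phi from -inf, which is why it is
  positive. The maximal error needs no joint optimisation in u and rho: by (L) the error is at most
  u g(u) (rho - (2/pi) arcsin rho), both u and g(u) are at most 1/2, with equality at u = 1/2, and a
  function of rho alone remains. With rho = sin t it is sin t - (2/pi) t, which is maximal where cos
  t = 2/pi.\<close>

abbreviation Phi :: "real \<Rightarrow> real" where "Phi \<equiv> std_normal_cdf"
abbreviation phi :: "real \<Rightarrow> real" where "phi \<equiv> std_normal_density"

text \<open>Many inequalities below compare two functions that agree in the limit at -inf, so the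
  sign of the derivative of their difference decides. This is the non-strict counterpart of
  \<open>DERIV_pos_imp_increasing_at_bot\<close>.\<close>

lemma nondecreasing_at_bot_limit_le:
  fixes f :: "real \<Rightarrow> real"
  assumes deriv: "\<And>x. x \<le> b \<Longrightarrow> (f has_real_derivative f' x) (at x)"
    and nonneg: "\<And>x. x \<le> b \<Longrightarrow> 0 \<le> f' x"
    and lim: "(f \<longlongrightarrow> L) at_bot"
  shows "L \<le> f b"
proof (rule tendsto_upperbound[OF lim])
  have "f x \<le> f b" if "x \<le> b" for x
    using that by (intro DERIV_nonneg_imp_nondecreasing[OF that]) (auto intro: deriv nonneg)
  then show "\<forall>\<^sub>F x in at_bot. f x \<le> f b"
    by (auto simp: eventually_at_bot_linorder)
qed simp

text \<open>The monotone form of l'Hopital's rule at \<open>-\<infinity>\<close>.\<close>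

lemma quotient_mono_of_deriv_quotient_mono:
  fixes f g r :: "real \<Rightarrow> real"
  assumes f: "\<And>x. x \<le> b \<Longrightarrow> (f has_real_derivative r x * g' x) (at x)"
    and g: "\<And>x. x \<le> b \<Longrightarrow> (g has_real_derivative g' x) (at x)"
    and g'_pos: "\<And>x. x \<le> b \<Longrightarrow> 0 < g' x"
    and f0: "(f \<longlongrightarrow> 0) at_bot" and g0: "(g \<longlongrightarrow> 0) at_bot"
    and r: "\<And>x y. x \<le> y \<Longrightarrow> y \<le> b \<Longrightarrow> r x \<le> r y"
    and xy: "x \<le> y" "y \<le> b"
  shows "f x / g x \<le> f y / g y"
proof -
  have g_pos: "0 < g t" if "t \<le> b" for t
    using that by (intro DERIV_pos_imp_increasing_at_bot[OF _ g0]) (meson g g'_pos order_trans)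
  \<comment> \<open>\<open>f t / g t\<close> is the mean of \<open>r\<close> over
    \<open>{..t}\<close> with weight \<open>g'\<close>, so it is at most the largest value
    \<open>r t\<close>. This is the sign of the derivative of the quotient.\<close>
  have r_bound: "f t \<le> r t * g t" if "t \<le> b" for t
  proof -
    have "0 \<le> r t * g t - f t"
    proof (rule nondecreasing_at_bot_limit_le
        [where f = "\<lambda>s. r t * g s - f s" and b = t and f' = "\<lambda>s. r t * g' s - r s * g' s"])
      show "((\<lambda>s. r t * g s - f s) \<longlongrightarrow> 0) at_bot"
        using f0 g0 by (auto intro!: tendsto_eq_intros)
      show "((\<lambda>s. r t * g s - f s) has_real_derivative r t * g' s - r s * g' s) (at s)"
        if "s \<le> t" for s
        using that \<open>t \<le> b\<close> by (intro DERIV_diff DERIV_cmult f g) auto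
      show "0 \<le> r t * g' s - r s * g' s" if "s \<le> t" for s
        using that \<open>t \<le> b\<close> r[of s t] g'_pos[of s] by (auto intro: mult_right_mono)
    qed
    then show ?thesis by simp
  qed
  show ?thesis
  proof (rule DERIV_nonneg_imp_nondecreasing[OF xy(1)], intro exI conjI)
    fix t assume "x \<le> t" "t \<le> y"
    then have t: "t \<le> b" using xy by simp
    show "((\<lambda>t. f t / g t) has_real_derivative
        (r t * g' t * g t - f t * g' t) / (g t * g t)) (at t)"
      using g_pos[OF t] by (intro DERIV_divide f g t) auto
    have "f t * g' t \<le> r t * g t * g' t"
      using r_bound[OF t] g'_pos[OF t] by (intro mult_right_mono) auto
    then show "0 \<le> (r t * g' t * g t - f t * g' t) / (g t * g t)"
      by (simp add: mult_ac)
  qed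
qed

text \<open>Cutting at \<open>x - 1\<close> leaves a constant plus an integral over a compact
  interval with \<open>x\<close> in reach of its interior, where the fundamental theorem of calculus
  applies.\<close>

lemma lower_integral_has_derivative:
  fixes f :: "real \<Rightarrow> real"
  assumes f: "integrable lborel f" and cont: "continuous_on UNIV f"
  shows "((\<lambda>x. LBINT t:{..x}. f t) has_real_derivative f x) (at x)"
proof -
  have si: "set_integrable lborel A f" if "A \<in> sets borel" for A
    using integrable_mult_indicator[OF _ f, of A] that by (simp add: set_integrable_def)
  have split: "(LBINT t:{..y}. f t) = (LBINT t:{..x - 1}. f t) + integral {x - 1..y} f"
    if "y \<in> {x - 1<..<x + 1}" for y
  proof -
    have "(LBINT t:{..x - 1} \<union> {x - 1<..y}. f t) =
        (LBINT t:{..x - 1}. f t) + (LBINT t:{x - 1<..y}. f t)"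
      by (intro set_integral_Un si) auto
    also have "{..x - 1} \<union> {x - 1<..y} = {..y}" using that by auto
    finally have "(LBINT t:{..y}. f t) = (LBINT t:{..x - 1}. f t) + (LBINT t:{x - 1<..y}. f t)" .
    also have "(LBINT t:{x - 1<..y}. f t) = (LBINT t:{x - 1..y}. f t)"
      unfolding set_lebesgue_integral_def
      by (rule integral_cong_AE)
        (use AE_lborel_singleton[of "x - 1"] f in \<open>auto simp: indicator_def\<close>)
    also have "\<dots> = integral {x - 1..y} f"
      by (rule set_borel_integral_eq_integral) (simp add: si)
    finally show ?thesis .
  qed
  have "((\<lambda>y. integral {x - 1..y} f) has_real_derivative f x) (at x within {x - 1..x + 1})"
    by (rule integral_has_real_derivative) (auto intro: continuous_on_subset[OF cont])
  then have "((\<lambda>y. integral {x - 1..y} f) has_real_derivative f x) (at x)"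
    by (simp add: at_within_Icc_at)
  then have "((\<lambda>y. (LBINT t:{..x - 1}. f t) + integral {x - 1..y} f) has_real_derivative f x) (at x)"
    by (auto intro!: derivative_eq_intros)
  then show ?thesis
    by (rule has_field_derivative_transform_within_open[where S = "{x - 1<..<x + 1}"])
      (auto simp: split)
qed

lemma Phi_eq_integral: "Phi x = (LBINT t:{..x}. phi t)"
proof -
  have "Phi x = enn2real (\<integral>\<^sup>+t. ennreal (phi t) * indicator {..x} t \<partial>lborel)"
    by (simp add: std_normal_cdf_def cdf_def2 measure_def emeasure_density)
  also have "\<dots> = (LBINT t:{..x}. phi t)"
    unfolding set_lebesgue_integral_def
    by (subst integral_eq_nn_integral)
      (auto intro!: arg_cong[where f = enn2real] nn_integral_cong simp: indicator_def)
  finally show ?thesis .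
qed

lemma continuous_on_phi: "continuous_on A phi"
  unfolding std_normal_density_def by (intro continuous_intros) auto

lemma Phi_deriv [derivative_intros]:
  "(Phi has_real_derivative phi x) (at x)"
proof -
  have "(\<lambda>x. LBINT t:{..x}. phi t) = Phi" by (simp add: Phi_eq_integral fun_eq_iff)
  then show ?thesis
    using lower_integral_has_derivative[of phi x] continuous_on_phi[of UNIV] by simp
qed

lemma Phi_deriv_chain [derivative_intros]:
  "(f has_real_derivative f') (at x within S) \<Longrightarrow>
    ((\<lambda>x. Phi (f x)) has_real_derivative phi (f x) * f') (at x within S)"
  using DERIV_chain2[OF Phi_deriv] .

lemma phi_deriv [derivative_intros]:
  assumes "(f has_real_derivative f') (at x within S)"
  shows "((\<lambda>x. phi (f x)) has_real_derivative - f x * phi (f x) * f') (at x within S)"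
proof -
  define c where "c = 1 / sqrt (2 * pi)"
  have "phi x = c * exp (- x\<^sup>2 / 2)" for x
    by (simp add: std_normal_density_def c_def)
  then show ?thesis
    using assms by (auto intro!: derivative_eq_intros simp: power2_eq_square)
qed

lemma phi_pos [simp]: "0 < phi x"
  by (simp add: normal_density_pos)

interpretation std_normal: real_distribution std_normal_distribution
  by (rule real_dist_normal_dist)

lemma Phi_at_bot: "(Phi \<longlongrightarrow> 0) at_bot"
  unfolding std_normal_cdf_def by (rule std_normal.cdf_lim_at_bot)

lemma Phi_at_top: "(Phi \<longlongrightarrow> 1) at_top"
  unfolding std_normal_cdf_def by (rule std_normal.cdf_lim_at_top_prob)

lemma Phi_pos [simp]: "0 < Phi x"
  by (rule DERIV_pos_imp_increasing_at_bot[OF _ Phi_at_bot]) (auto intro: Phi_deriv)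

lemma Phi_le_1: "Phi x \<le> 1"
  unfolding std_normal_cdf_def by (rule std_normal.cdf_bounded_prob)

lemma Phi_less: "x < y \<Longrightarrow> Phi x < Phi y"
  by (rule DERIV_pos_imp_increasing) (auto intro: Phi_deriv)

lemma Phi_mono: "x \<le> y \<Longrightarrow> Phi x \<le> Phi y"
  using Phi_less[of x y] by (cases "x = y") auto


lemma continuous_on_Phi: "continuous_on A Phi"
  by (rule DERIV_continuous_on) (auto intro: has_field_derivative_at_within Phi_deriv)

text \<open>As \<open>phi\<close> is even, \<open>Phi x + Phi (- x)\<close> has derivative 0; its
  constant value is found in the limit at infinity.\<close>

lemma Phi_0: "Phi 0 = 1/2"
proof -
  have "Phi x + Phi (- x) = Phi 0 + Phi (- 0)" for x
    by (rule DERIV_isconst_all)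
      (auto intro!: derivative_eq_intros simp: std_normal_density_def)
  then have const: "Phi x + Phi (- x) = 2 * Phi 0" for x
    by simp
  have "((\<lambda>x. Phi x + Phi (- x)) \<longlongrightarrow> 1 + 0) at_top"
    by (intro tendsto_intros Phi_at_top filterlim_compose[OF Phi_at_bot]
        filterlim_uminus_at_bot_at_top)
  then have "((\<lambda>x::real. 2 * Phi 0) \<longlongrightarrow> 1) at_top"
    unfolding const by simp
  then show ?thesis by (simp add: tendsto_const_iff)
qed

lemma ex_Phi_eq:
  assumes "0 < u" "u < 1"
  shows "\<exists>x. Phi x = u"
proof -
  have "\<forall>\<^sub>F x in at_bot. Phi x < u" "\<forall>\<^sub>F x in at_top. u < Phi x"
    using Phi_at_bot Phi_at_top assms by (auto dest: order_tendstoD)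
  then obtain a b where ab: "Phi a < u" "u < Phi b"
    by (metis eventually_at_bot_linorder eventually_at_top_linorder order_refl)
  then have "a \<le> b" using Phi_mono[of b a] by linarith
  then show ?thesis
    using IVT'[of Phi a u b] ab continuous_on_Phi by auto
qed

lemma std_normal_quantile_Phi [simp]: "std_normal_quantile (Phi h) = h"
proof -
  have "inj Phi" by (rule injI) (metis Phi_less less_irrefl linorder_neqE)
  then show ?thesis by (simp add: std_normal_quantile_def)
qed

lemma half_Phi_cases:
  assumes "0 < u" "u \<le> 1/2"
  obtains h where "h \<le> 0" "u = Phi h"
proof -
  obtain h where h: "Phi h = u" using ex_Phi_eq[of u] assms by auto
  then have "h \<le> 0" using Phi_less[of 0 h] assms Phi_0 by (cases "0 < h") auto
  with h that show ?thesis by blast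
qed

subsection \<open>The reversed Mills ratio\<close>

lemma phi_at_bot: "(phi \<longlongrightarrow> 0) at_bot"
  unfolding std_normal_density_def by real_asymp

lemma times_phi_at_bot: "((\<lambda>t. t * phi t) \<longlongrightarrow> 0) at_bot"
  unfolding std_normal_density_def by real_asymp

text \<open>The direct proof of \<open>mills_upper\<close> needs that \<open>t * Phi t\<close>
  vanishes at -inf, which is itself a consequence of such a bound. Division by \<open>t\<close>
  breaks the circle: both terms of \<open>- phi s / s - Phi s\<close> obviously tend to 0.\<close>

lemma mills_upper_weak:
  assumes "t < 0"
  shows "0 \<le> phi t + t * Phi t"
proof -
  have "0 \<le> - phi t / t - Phi t"
  proof (rule nondecreasing_at_bot_limit_le
      [where f = "\<lambda>s. - phi s / s - Phi s" and b = t and f' = "\<lambda>s. phi s / s\<^sup>2"])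
    show "((\<lambda>s. - phi s / s - Phi s) \<longlongrightarrow> 0) at_bot"
    proof -
      have "((\<lambda>s. - phi s / s) \<longlongrightarrow> 0) at_bot"
        unfolding std_normal_density_def by real_asymp
      from tendsto_diff[OF this Phi_at_bot] show ?thesis by simp
    qed
    show "((\<lambda>s. - phi s / s - Phi s) has_real_derivative phi s / s\<^sup>2) (at s)" if "s \<le> t" for s
      using that assms
      by (auto intro!: derivative_eq_intros simp: field_simps power2_eq_square)
  qed simp
  then show ?thesis using assms by (simp add: field_simps)
qed

lemma times_Phi_at_bot: "((\<lambda>t. t * Phi t) \<longlongrightarrow> 0) at_bot"
proof (rule tendsto_sandwich[where f = "\<lambda>t. - phi t" and h = "\<lambda>_. 0"])
  have *: "- phi t \<le> t * Phi t \<and> t * Phi t \<le> 0" if "t \<le> - 1" for t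
    using mills_upper_weak[of t] that by (auto simp: mult_nonpos_nonneg less_imp_le)
  show "\<forall>\<^sub>F t in at_bot. - phi t \<le> t * Phi t" "\<forall>\<^sub>F t in at_bot. t * Phi t \<le> 0"
    using * unfolding eventually_at_bot_linorder by blast+
qed (use phi_at_bot in \<open>auto intro!: tendsto_eq_intros\<close>)

lemma square_times_Phi_at_bot: "((\<lambda>t. t\<^sup>2 * Phi t) \<longlongrightarrow> 0) at_bot"
proof (rule tendsto_sandwich[where f = "\<lambda>_. 0" and h = "\<lambda>t. - (t * phi t)"])
  have "t\<^sup>2 * Phi t \<le> - (t * phi t)" if "t \<le> - 1" for t
    using mult_nonpos_nonneg[of t "phi t + t * Phi t"] mills_upper_weak[of t] that
    by (simp add: algebra_simps power2_eq_square)
  then show "\<forall>\<^sub>F t in at_bot. t\<^sup>2 * Phi t \<le> - (t * phi t)"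
    unfolding eventually_at_bot_linorder by blast
  show "((\<lambda>t. - (t * phi t)) \<longlongrightarrow> 0) at_bot"
    using tendsto_minus[OF times_phi_at_bot] by simp
qed (auto simp: less_imp_le)

text \<open>The expression is the integral of \<open>Phi\<close> over \<open>{..t}\<close>: its
  derivative is \<open>Phi\<close> and it vanishes at -inf.\<close>

lemma mills_upper: "0 < phi t + t * Phi t"
proof (rule DERIV_pos_imp_increasing_at_bot[where f = "\<lambda>t. phi t + t * Phi t" and b = t])
  show "((\<lambda>t. phi t + t * Phi t) \<longlongrightarrow> 0) at_bot"
    using tendsto_add[OF phi_at_bot times_Phi_at_bot] by simp
  fix s
  have "((\<lambda>t. phi t + t * Phi t) has_real_derivative Phi s) (at s)"
    by (auto intro!: derivative_eq_intros)
  then show "\<exists>y. ((\<lambda>t. phi t + t * Phi t) has_real_derivative y) (at s) \<and> y > 0"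
    using Phi_pos by blast
qed

text \<open>The derivative is twice the expression in \<open>mills_upper\<close>. For a standard
  normal X the left side is the expectation of (t - X)^2 on the event X <= t.\<close>

lemma mills_lower: "0 < (1 + t\<^sup>2) * Phi t + t * phi t"
proof (rule DERIV_pos_imp_increasing_at_bot[where f = "\<lambda>t. (1 + t\<^sup>2) * Phi t + t * phi t" and b = t])
  show "((\<lambda>t. (1 + t\<^sup>2) * Phi t + t * phi t) \<longlongrightarrow> 0) at_bot"
    using tendsto_add[OF tendsto_add[OF Phi_at_bot square_times_Phi_at_bot] times_phi_at_bot]
    by (simp add: algebra_simps)
  fix s
  have "((\<lambda>t. (1 + t\<^sup>2) * Phi t + t * phi t) has_real_derivative 2 * (phi s + s * Phi s)) (at s)"
    by (auto intro!: derivative_eq_intros simp: algebra_simps power2_eq_square)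
  then show "\<exists>y. ((\<lambda>t. (1 + t\<^sup>2) * Phi t + t * phi t) has_real_derivative y) (at s) \<and> y > 0"
    using mills_upper[of s] by fastforce
qed

text \<open>By symmetry this is the classical Mills ratio (1 - Phi) / phi at
  \<open>- t\<close>.\<close>

definition mills :: "real \<Rightarrow> real" where "mills t = Phi t / phi t"

lemma mills_pos [simp]: "0 < mills t"
  by (simp add: mills_def)

lemma mills_deriv: "(mills has_real_derivative 1 + t * mills t) (at t)"
  unfolding mills_def
  by (auto intro!: derivative_eq_intros simp: divide_simps less_imp_neq[OF phi_pos, symmetric])
    (simp add: algebra_simps)

lemma mills_deriv_chain [derivative_intros]:
  "(f has_real_derivative f') (at x within S) \<Longrightarrow>
    ((\<lambda>x. mills (f x)) has_real_derivative (1 + f x * mills (f x)) * f') (at x within S)"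
  using DERIV_chain2[OF mills_deriv] .

lemma times_mills_mono:
  assumes "s \<le> t"
  shows "s * mills s \<le> t * mills t"
proof (rule DERIV_nonneg_imp_nondecreasing[OF assms], intro exI conjI)
  fix x
  show "((\<lambda>t. t * mills t) has_real_derivative (1 + x\<^sup>2) * mills x + x) (at x)"
    by (auto intro!: derivative_eq_intros simp: algebra_simps power2_eq_square)
  have "(1 + x\<^sup>2) * mills x + x = ((1 + x\<^sup>2) * Phi x + x * phi x) / phi x"
    using less_imp_neq[OF phi_pos, of x] by (simp add: mills_def field_simps)
  then show "0 \<le> (1 + x\<^sup>2) * mills x + x"
    using mills_lower[of x] by (simp add: divide_pos_pos less_imp_le)
qed

text \<open>The monotone quantity is \<open>t\<close> times the logarithmic derivative of \<open>mills\<close>.\<close>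

lemma mills_elasticity_mono:
  assumes "s \<le> t"
  shows "s / mills s + s\<^sup>2 \<le> t / mills t + t\<^sup>2"
proof -
  have eq: "x / mills x + x\<^sup>2 = (x * phi x + x\<^sup>2 * Phi x) / Phi x" for x
    using less_imp_neq[OF Phi_pos, of x] by (simp add: mills_def field_simps)
  \<comment> \<open>Second use of the monotone rule: \<open>x * phi x + x^2 * Phi x\<close> has
    derivative \<open>phi x + 2 * x * Phi x\<close>, because the terms with
    \<open>x^2 * phi x\<close> cancel.\<close>
  show ?thesis unfolding eq
  proof (rule quotient_mono_of_deriv_quotient_mono
      [where b = t and g' = phi and r = "\<lambda>x. 1 + 2 * (x * mills x)"])
    show "((\<lambda>x. x * phi x + x\<^sup>2 * Phi x) has_real_derivative (1 + 2 * (x * mills x)) * phi x) (at x)" for x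
      using less_imp_neq[OF phi_pos, of x]
      by (auto intro!: derivative_eq_intros simp: mills_def algebra_simps power2_eq_square)
    show "((\<lambda>x. x * phi x + x\<^sup>2 * Phi x) \<longlongrightarrow> 0) at_bot"
      using tendsto_add[OF times_phi_at_bot square_times_Phi_at_bot] by simp
  qed (use assms Phi_at_bot in \<open>auto intro: Phi_deriv times_mills_mono\<close>)
qed

lemma mills_ratio_mono:
  assumes l: "0 < l" "l \<le> 1" and st: "s \<le> t" "t \<le> 0"
  shows "mills s / mills (l * s) \<le> mills t / mills (l * t)"
proof (rule DERIV_nonneg_imp_nondecreasing[OF st(1)], intro exI conjI)
  fix x assume "s \<le> x" "x \<le> t"
  then have "x \<le> 0" using st by simp
  let ?N = "(1 + x * mills x) * mills (l * x) - mills x * ((1 + l * x * mills (l * x)) * l)"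
  show "((\<lambda>t. mills t / mills (l * t)) has_real_derivative ?N / (mills (l * x) * mills (l * x))) (at x)"
    by (auto intro!: derivative_eq_intros simp: less_imp_neq[OF mills_pos, symmetric])
  have "0 \<le> ?N"
  \<comment> \<open>The comparison of elasticities at \<open>x <= l * x\<close> gives only
    \<open>x * ?N <= 0\<close>, which says nothing at 0; there \<open>?N\<close> equals
    \<open>(1 - l) * mills 0\<close>.\<close>
  proof (cases "x = 0")
    case True
    then show ?thesis using mult_right_mono[OF l(2), of "mills 0"]
      by (simp add: less_imp_le mult.commute)
  next
    case False
    then have "x < 0" using \<open>x \<le> 0\<close> by simp
    have "x \<le> l * x" using mult_right_mono_neg[OF l(2), of x] \<open>x \<le> 0\<close> by simp
    from mills_elasticity_mono[OF this]
    have "(x / mills x + x\<^sup>2) * (mills x * mills (l * x)) 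
        \<le> (l * x / mills (l * x) + (l * x)\<^sup>2) * (mills x * mills (l * x))"
      by (intro mult_right_mono) (auto simp: less_imp_le)
    moreover have "(x / mills x + x\<^sup>2) * (mills x * mills (l * x)) =
        (x + x\<^sup>2 * mills x) * mills (l * x)"
      by (simp add: distrib_right less_imp_neq[OF mills_pos, symmetric])
    moreover have "(l * x / mills (l * x) + (l * x)\<^sup>2) * (mills x * mills (l * x)) =
        (l * x + (l * x)\<^sup>2 * mills (l * x)) * mills x"
      by (simp add: distrib_right less_imp_neq[OF mills_pos, symmetric])
    ultimately have "x * ?N \<le> 0"
      by (simp add: algebra_simps power2_eq_square)
    then show ?thesis using \<open>x < 0\<close> by (simp add: mult_le_0_iff)
  qed
  then show "0 \<le> ?N / (mills (l * x) * mills (l * x))" by simp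
qed

lemma times_mills_at_bot: "((\<lambda>t. - t * mills t) \<longlongrightarrow> 1) at_bot"
proof (rule tendsto_sandwich[where f = "\<lambda>t. t\<^sup>2 / (1 + t\<^sup>2)" and h = "\<lambda>_. 1"])
  have *: "t\<^sup>2 / (1 + t\<^sup>2) \<le> - t * mills t \<and> - t * mills t \<le> 1" if "t \<le> - 1" for t :: real
  proof -
    have "(- t) * (- t * phi t) \<le> (- t) * ((1 + t\<^sup>2) * Phi t)"
      using mills_lower[of t] that by (intro mult_left_mono) auto
    moreover have "0 < 1 + t\<^sup>2" by (simp add: add_pos_nonneg)
    ultimately have "t\<^sup>2 / (1 + t\<^sup>2) \<le> - t * mills t"
      by (simp add: mills_def divide_simps power2_eq_square mult_ac)
    moreover have "- t * mills t \<le> 1"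
      using mills_upper[of t] by (simp add: mills_def field_simps)
    ultimately show ?thesis by simp
  qed
  show "\<forall>\<^sub>F t in at_bot. t\<^sup>2 / (1 + t\<^sup>2) \<le> - t * mills t" "\<forall>\<^sub>F t in at_bot. - t * mills t \<le> 1"
    using * unfolding eventually_at_bot_linorder by blast+
  show "((\<lambda>t::real. t\<^sup>2 / (1 + t\<^sup>2)) \<longlongrightarrow> 1) at_bot" by real_asymp
qed simp

text \<open>Near -inf, \<open>mills t\<close> behaves like -1/t, so the ratio behaves like (l t) /
  t.\<close>

lemma mills_ratio_at_bot:
  assumes l: "0 < l"
  shows "((\<lambda>t. mills t / mills (l * t)) \<longlongrightarrow> l) at_bot"
proof -
  have "filterlim (\<lambda>t. l * t) at_bot at_bot"
    using l by real_asymp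
  then have "((\<lambda>t. - (l * t) * mills (l * t)) \<longlongrightarrow> 1) at_bot"
    by (rule filterlim_compose[OF times_mills_at_bot])
  then have "((\<lambda>t. l * ((- t * mills t) / (- (l * t) * mills (l * t)))) \<longlongrightarrow> l * (1 / 1)) at_bot"
    by (intro tendsto_intros times_mills_at_bot) auto
  moreover have "\<forall>\<^sub>F t in at_bot. l * ((- t * mills t) / (- (l * t) * mills (l * t))) = mills t / mills (l * t)"
    by (rule eventually_mono[OF eventually_le_at_bot[of "- 1"]]) (use l in auto)
  ultimately have "((\<lambda>t. mills t / mills (l * t)) \<longlongrightarrow> l * (1 / 1)) at_bot"
    by (rule Lim_transform_eventually)
  then show ?thesis by simp
qed

subsection \<open>The bivariate normal distribution function\<close>

text \<open>For rho = cos alpha with alpha in [0, pi) this is tan (alpha / 2), which is how an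
  arctangent of \<open>lam\<close> becomes an arcsine of rho.\<close>

definition lam :: "real \<Rightarrow> real" where "lam \<rho> = sqrt ((1 - \<rho>) / (1 + \<rho>))"

lemma bvn_density_symmetric: "bvn_density x y \<rho> = bvn_density y x \<rho>"
  by (simp add: bvn_density_def algebra_simps)

text \<open>Marginal times conditional density: given the first coordinate x, the second one is
  normal with mean rho x and variance 1 - rho^2. The exponents agree by completing the square in
  y.\<close>

lemma bvn_density_eq:
  assumes "\<bar>\<rho>\<bar> < 1"
  shows "bvn_density x y \<rho> = phi x * normal_density (\<rho> * x) (sqrt (1 - \<rho>\<^sup>2)) y"
proof -
  have pos: "0 < 1 - \<rho>\<^sup>2" using assms by (simp add: abs_square_less_1)
  have "- (x\<^sup>2 - 2 * \<rho> * x * y + y\<^sup>2) / (2 * (1 - \<rho>\<^sup>2)) = - x\<^sup>2 / 2 - (y - \<rho> * x)\<^sup>2 / (2 * (1 - \<rho>\<^sup>2))"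
    using pos by (simp add: divide_simps) (simp add: algebra_simps power2_eq_square)
  moreover have "sqrt (2 * pi * (1 - \<rho>\<^sup>2)) * sqrt (2 * pi) = 2 * pi * sqrt (1 - \<rho>\<^sup>2)"
  proof -
    have "sqrt (c * d) * sqrt c = c * sqrt d" if "0 \<le> c" for c d
      by (metis abs_of_nonneg mult.assoc mult.commute real_sqrt_mult real_sqrt_mult_self that)
    from this[of "2 * pi"] show ?thesis by simp
  qed
  ultimately show ?thesis
    using pos
    by (simp add: bvn_density_def std_normal_density_def normal_density_def exp_add[symmetric]
        mult_exp_exp divide_simps real_sqrt_mult)
qed

lemma nn_integral_normal_density_atMost:
  assumes "0 < \<sigma>"
  shows "(\<integral>\<^sup>+y. ennreal (normal_density \<mu> \<sigma> y) * indicator {..k} y \<partial>lborel) =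
    ennreal (Phi ((k - \<mu>) / \<sigma>))"
proof -
  have "(\<integral>\<^sup>+y. ennreal (normal_density \<mu> \<sigma> y) * indicator {..k} y \<partial>lborel) =
      ennreal \<bar>\<sigma>\<bar> * (\<integral>\<^sup>+y. ennreal (normal_density \<mu> \<sigma> (\<mu> + \<sigma> * y)) *
        indicator {..k} (\<mu> + \<sigma> * y) \<partial>lborel)"
    using assms by (intro nn_integral_real_affine) auto
  also have "\<dots> = (\<integral>\<^sup>+y. ennreal (phi y) * indicator {..(k - \<mu>) / \<sigma>} y \<partial>lborel)"
  proof (subst nn_integral_cmult[symmetric], simp, rule nn_integral_cong)
    fix y :: real
    have "\<sigma> * normal_density \<mu> \<sigma> (\<mu> + \<sigma> * y) = phi y"
      using assms by (simp add: normal_density_def std_normal_density_def real_sqrt_mult power_mult_distrib)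
    moreover have "\<mu> + \<sigma> * y \<le> k \<longleftrightarrow> y \<le> (k - \<mu>) / \<sigma>"
      using assms by (simp add: field_simps)
    ultimately show "ennreal \<bar>\<sigma>\<bar> * (ennreal (normal_density \<mu> \<sigma> (\<mu> + \<sigma> * y)) *
        indicator {..k} (\<mu> + \<sigma> * y)) = ennreal (phi y) * indicator {..(k - \<mu>) / \<sigma>} y"
      using assms by (simp add: indicator_def ennreal_mult[symmetric])
  qed
  also have "\<dots> = emeasure std_normal_distribution {..(k - \<mu>) / \<sigma>}"
    by (simp add: emeasure_density)
  also have "\<dots> = ennreal (Phi ((k - \<mu>) / \<sigma>))"
    by (simp add: std_normal_cdf_def cdf_def2 std_normal.emeasure_eq_measure)
  finally show ?thesis .
qed

lemma borel_measurable_Phi [measurable]: "Phi \<in> borel_measurable borel"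
  using continuous_on_Phi by (rule borel_measurable_continuous_onI)

lemma inner_bvn_integral:
  assumes "\<bar>\<rho>\<bar> < 1"
  shows "(\<integral>\<^sup>+y. ennreal (bvn_density x y \<rho>) * indicator {..k} y \<partial>lborel) =
    ennreal (phi x * Phi ((k - \<rho> * x) / sqrt (1 - \<rho>\<^sup>2)))"
proof -
  have "0 < sqrt (1 - \<rho>\<^sup>2)" using assms by (simp add: abs_square_less_1)
  then show ?thesis
    by (simp add: bvn_density_eq[OF assms] ennreal_mult nn_integral_cmult mult.assoc
        nn_integral_normal_density_atMost less_imp_le)
qed

lemma integrable_phi_times_Phi:
  assumes [measurable]: "f \<in> borel_measurable borel"
  shows "integrable lborel (\<lambda>x. phi x * Phi (f x))"
  by (rule Bochner_Integration.integrable_bound[of _ phi])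
    (auto simp: abs_mult Phi_le_1 less_imp_le intro!: mult_left_le)

text \<open>This moves to integrals where Tonelli's theorem applies. If the integral is infinite,
  both sides are 0: the Bochner integral by its default value, the right side by
  \<open>enn2real\<close> at infinity.\<close>

lemma set_lebesgue_integral_eq_nn_integral:
  fixes f :: "real \<Rightarrow> real"
  assumes [measurable]: "f \<in> borel_measurable borel" "A \<in> sets borel" and "\<And>x. 0 \<le> f x"
  shows "(LBINT x:A. f x) = enn2real (\<integral>\<^sup>+x. ennreal (f x) * indicator A x \<partial>lborel)"
  unfolding set_lebesgue_integral_def
  using assms(3) by (subst integral_eq_nn_integral)
    (auto intro!: arg_cong[where f = enn2real] nn_integral_cong simp: indicator_def)

lemma bvn_cdf_eq:
  assumes "\<bar>\<rho>\<bar> < 1"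
  shows "bvn_cdf h k \<rho> = (LBINT x:{..h}. phi x * Phi ((k - \<rho> * x) / sqrt (1 - \<rho>\<^sup>2)))"
proof -
  have nonneg: "0 \<le> bvn_density x y \<rho>" for x y
    by (simp add: bvn_density_eq[OF assms])
  have [measurable]: "(\<lambda>y. bvn_density x y \<rho>) \<in> borel_measurable borel" for x
    unfolding bvn_density_def by measurable
  show ?thesis
    by (simp add: bvn_cdf_def set_lebesgue_integral_eq_nn_integral nonneg
        inner_bvn_integral[OF assms] less_imp_le)
qed

text \<open>These crude bounds supply the limit 0 at -inf and the value of the copula at the corner
  (0, 0).\<close>

lemma bvn_cdf_nonneg_le_Phi:
  assumes "\<bar>\<rho>\<bar> < 1"
  shows "0 \<le> bvn_cdf h k \<rho>" "bvn_cdf h k \<rho> \<le> Phi h"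
proof -
  show "0 \<le> bvn_cdf h k \<rho>"
    unfolding bvn_cdf_eq[OF assms] set_lebesgue_integral_def
    by (intro Bochner_Integration.integral_nonneg) (auto simp: less_imp_le)
  show "bvn_cdf h k \<rho> \<le> Phi h"
    unfolding bvn_cdf_eq[OF assms] Phi_eq_integral[of h] set_lebesgue_integral_def
    by (intro integral_mono integrable_mult_indicator integrable_phi_times_Phi)
      (auto simp: indicator_def Phi_le_1 less_imp_le intro!: mult_left_le)
qed

text \<open>Both halves \<open>y \<le> x\<close> and \<open>x < y\<close> of the quadrant contribute equally, by symmetry.\<close>

lemma bvn_cdf_diagonal:
  assumes "\<bar>\<rho>\<bar> < 1"
  shows "bvn_cdf h h \<rho> = (LBINT x:{..h}. 2 * (phi x * Phi (lam \<rho> * x)))"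
proof -
  define f where "f x y = ennreal (bvn_density x y \<rho>)" for x y
  have [measurable]: "(\<lambda>(x, y). f x y) \<in> borel_measurable (borel \<Otimes>\<^sub>M borel)"
    unfolding f_def bvn_density_def by measurable
  have f_sym: "f x y = f y x" for x y
    by (simp add: f_def bvn_density_symmetric)
  \<comment> \<open>The inner integral up to \<open>y = x\<close> has the standardised end point (1
    - rho) x / sqrt (1 - rho^2); cancelling sqrt (1 - rho) leaves \<open>lam\<close>.\<close>
  have lam: "(x - \<rho> * x) / sqrt (1 - \<rho>\<^sup>2) = lam \<rho> * x" for x
  proof -
    define a b where "a = sqrt (1 - \<rho>)" and "b = sqrt (1 + \<rho>)"
    have "0 < a" "0 < b" using assms by (auto simp: a_def b_def)
    have "1 - \<rho>\<^sup>2 = (1 - \<rho>) * (1 + \<rho>)" by (simp add: algebra_simps power2_eq_square)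
    then have "sqrt (1 - \<rho>\<^sup>2) = a * b" by (simp add: a_def b_def real_sqrt_mult)
    moreover have "x - \<rho> * x = (a * a) * x" using assms by (simp add: a_def algebra_simps)
    moreover have "lam \<rho> = a / b" by (simp add: lam_def a_def b_def real_sqrt_divide)
    ultimately show ?thesis using \<open>0 < a\<close> \<open>0 < b\<close> by simp
  qed
  have lower: "(\<integral>\<^sup>+y. f x y * indicator {..x} y \<partial>lborel) = ennreal (phi x * Phi (lam \<rho> * x))" for x
    by (simp add: f_def inner_bvn_integral[OF assms] lam)
  have inner: "(\<integral>\<^sup>+y. f x y * indicator {..h} y \<partial>lborel) =
      ennreal (phi x * Phi ((h - \<rho> * x) / sqrt (1 - \<rho>\<^sup>2)))" for x
    by (simp add: f_def inner_bvn_integral[OF assms])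
  \<comment> \<open>The indicator of an interval that depends on x is rewritten as a product, so
    that its joint measurability in x and y is visible when the integrals are exchanged.\<close>
  have "(\<integral>\<^sup>+x. \<integral>\<^sup>+y. f x y * indicator {x<..h} y \<partial>lborel \<partial>lborel) =
      (\<integral>\<^sup>+x. \<integral>\<^sup>+y. f x y * (indicator {..h} y * (if x < y then 1 else 0)) \<partial>lborel \<partial>lborel)"
    by (intro nn_integral_cong) (auto simp: indicator_def)
  also have "\<dots> = (\<integral>\<^sup>+y. \<integral>\<^sup>+x. f x y * (indicator {..h} y * (if x < y then 1 else 0)) \<partial>lborel \<partial>lborel)"
    by (rule lborel_pair.Fubini') measurable
  \<comment> \<open>Reflection maps x < y <= h to the other half. Passing from x < y to x <= y adds
    a single point for each y, a null set.\<close>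
  also have "\<dots> = (\<integral>\<^sup>+y. \<integral>\<^sup>+x. (f y x * indicator {..y} x) * indicator {..h} y \<partial>lborel \<partial>lborel)"
    by (intro nn_integral_cong nn_integral_cong_AE)
      (auto simp: indicator_def f_sym intro: eventually_mono[OF AE_lborel_singleton])
  also have "\<dots> = (\<integral>\<^sup>+y. ennreal (phi y * Phi (lam \<rho> * y)) * indicator {..h} y \<partial>lborel)"
    by (subst nn_integral_multc) (auto simp: lower)
  finally have upper: "(\<integral>\<^sup>+x. \<integral>\<^sup>+y. f x y * indicator {x<..h} y \<partial>lborel \<partial>lborel) =
    (\<integral>\<^sup>+y. ennreal (phi y * Phi (lam \<rho> * y)) * indicator {..h} y \<partial>lborel)" .
  have "(\<integral>\<^sup>+x. ennreal (phi x * Phi ((h - \<rho> * x) / sqrt (1 - \<rho>\<^sup>2))) * indicator {..h} x \<partial>lborel) =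
      (\<integral>\<^sup>+x. (\<integral>\<^sup>+y. f x y * indicator {..x} y \<partial>lborel) * indicator {..h} x +
        (\<integral>\<^sup>+y. f x y * indicator {x<..h} y \<partial>lborel) \<partial>lborel)"
  proof (rule nn_integral_cong)
    fix x
    show "ennreal (phi x * Phi ((h - \<rho> * x) / sqrt (1 - \<rho>\<^sup>2))) * indicator {..h} x =
      (\<integral>\<^sup>+y. f x y * indicator {..x} y \<partial>lborel) * indicator {..h} x +
      (\<integral>\<^sup>+y. f x y * indicator {x<..h} y \<partial>lborel)"
    proof (cases "x \<le> h")
      case True
      have "(\<integral>\<^sup>+y. f x y * indicator {..h} y \<partial>lborel) =
          (\<integral>\<^sup>+y. f x y * indicator {..x} y + f x y * indicator {x<..h} y \<partial>lborel)"
        using True by (intro nn_integral_cong) (auto simp: indicator_def)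
      also have "\<dots> = (\<integral>\<^sup>+y. f x y * indicator {..x} y \<partial>lborel) +
          (\<integral>\<^sup>+y. f x y * indicator {x<..h} y \<partial>lborel)"
        by (rule nn_integral_add) auto
      finally show ?thesis using True by (simp add: inner)
    qed (auto simp: indicator_def)
  qed
  also have "\<dots> = (\<integral>\<^sup>+x. (\<integral>\<^sup>+y. f x y * indicator {..x} y \<partial>lborel) * indicator {..h} x \<partial>lborel) +
      (\<integral>\<^sup>+x. (\<integral>\<^sup>+y. f x y * indicator {x<..h} y \<partial>lborel) \<partial>lborel)"
  proof (rule nn_integral_add)
    have "(\<lambda>x. \<integral>\<^sup>+y. f x y * (indicator {..h} y * (if x < y then 1 else 0)) \<partial>lborel) \<in> borel_measurable lborel"
      by measurable
    also have "(\<lambda>x. \<integral>\<^sup>+y. f x y * (indicator {..h} y * (if x < y then 1 else 0)) \<partial>lborel) =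
        (\<lambda>x. \<integral>\<^sup>+y. f x y * indicator {x<..h} y \<partial>lborel)"
      by (intro ext nn_integral_cong) (auto simp: indicator_def)
    finally show "(\<lambda>x. \<integral>\<^sup>+y. f x y * indicator {x<..h} y \<partial>lborel) \<in> borel_measurable lborel" .
  qed (simp add: lower)
  also have "\<dots> = (\<integral>\<^sup>+x. ennreal (2 * (phi x * Phi (lam \<rho> * x))) * indicator {..h} x \<partial>lborel)"
    unfolding upper lower
    by (subst nn_integral_add[symmetric])
      (auto intro!: nn_integral_cong simp: indicator_def ennreal_plus[symmetric] less_imp_le simp del: ennreal_plus)
  finally show ?thesis
    by (simp add: bvn_cdf_eq[OF assms] set_lebesgue_integral_eq_nn_integral less_imp_le
        del: set_integral_mult_right)
qed

text \<open>Substitute \<open>s = t * w\<close> in the inner integral over \<open>s\<close>, then exchange the integrals.\<close>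

lemma wedge_probability:
  assumes "0 \<le> l"
  shows "(LBINT t:{..0}. 2 * (phi t * Phi (l * t))) = 1/2 - arctan l / pi"
proof -
  \<comment> \<open>For t < 0 the substitution reverses the order, so s <= l t becomes w >= l. At t
    = 0 it degenerates, hence equality only almost everywhere.\<close>
  have inner: "ennreal (2 * (phi t * Phi (l * t))) * indicator {..0} t =
      (\<integral>\<^sup>+w. ennreal (- t * exp (- (1 + w\<^sup>2) * t\<^sup>2 / 2) / pi) * indicator {l..} w * indicator {..0} t \<partial>lborel)"
    if "t \<noteq> 0" for t
  proof (cases "t < 0")
    case True
    have "(\<integral>\<^sup>+s. ennreal (phi s) * indicator {..l * t} s \<partial>lborel) = ennreal (Phi (l * t))"
      using nn_integral_normal_density_atMost[of 1 0 "l * t"] by simp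
    also have "(\<integral>\<^sup>+s. ennreal (phi s) * indicator {..l * t} s \<partial>lborel) =
        ennreal \<bar>t\<bar> * (\<integral>\<^sup>+w. ennreal (phi (0 + t * w)) * indicator {..l * t} (0 + t * w) \<partial>lborel)"
      using True by (intro nn_integral_real_affine) auto
    finally have "ennreal (2 * phi t) * (ennreal \<bar>t\<bar> *
        (\<integral>\<^sup>+w. ennreal (phi (0 + t * w)) * indicator {..l * t} (0 + t * w) \<partial>lborel)) =
        ennreal (2 * (phi t * Phi (l * t)))"
      by (simp add: ennreal_mult less_imp_le mult.assoc)
    moreover have "ennreal (2 * phi t) * (ennreal \<bar>t\<bar> *
        (\<integral>\<^sup>+w. ennreal (phi (0 + t * w)) * indicator {..l * t} (0 + t * w) \<partial>lborel)) =
        (\<integral>\<^sup>+w. ennreal (2 * phi t) * (ennreal \<bar>t\<bar> *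
          (ennreal (phi (0 + t * w)) * indicator {..l * t} (0 + t * w))) \<partial>lborel)"
      by (subst nn_integral_cmult[symmetric], simp)+ simp
    moreover have "\<dots> = (\<integral>\<^sup>+w. ennreal (- t * exp (- (1 + w\<^sup>2) * t\<^sup>2 / 2) / pi) *
        indicator {l..} w * indicator {..0} t \<partial>lborel)"
    proof (rule nn_integral_cong)
      fix w
      have "t * w \<le> l * t \<longleftrightarrow> l \<le> w" using True by (simp add: mult.commute)
      have eq: "2 * phi t * (\<bar>t\<bar> * phi (0 + t * w)) = - t * exp (- (1 + w\<^sup>2) * t\<^sup>2 / 2) / pi"
        using True
        by (simp add: std_normal_density_def real_sqrt_mult mult_exp_exp field_simps)
      moreover have "ennreal (2 * phi t) * (ennreal \<bar>t\<bar> * ennreal (phi (0 + t * w))) =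
          ennreal (- t * exp (- (1 + w\<^sup>2) * t\<^sup>2 / 2) / pi)"
        unfolding eq[symmetric]
        by (simp only: ennreal_mult normal_density_nonneg abs_ge_zero mult_nonneg_nonneg zero_le_numeral)
      ultimately show "ennreal (2 * phi t) * (ennreal \<bar>t\<bar> *
          (ennreal (phi (0 + t * w)) * indicator {..l * t} (0 + t * w))) =
        ennreal (- t * exp (- (1 + w\<^sup>2) * t\<^sup>2 / 2) / pi) * indicator {l..} w * indicator {..0} t"
        using True by (simp add: indicator_def)
    qed
    ultimately show ?thesis using True by simp
  qed (use that in simp)
  \<comment> \<open>The factor t gained from the substitution gives the Gaussian in t an elementary
    antiderivative; it is applied with c = 1 + w^2.\<close>
  have outer: "(\<integral>\<^sup>+t. ennreal (- t * exp (- c * t\<^sup>2 / 2) / pi) * indicator {..0} t \<partial>lborel) =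
      ennreal (1 / (pi * c))" if pos: "0 < c" for c :: real
  proof -
    have "(\<integral>\<^sup>+t. ennreal (- t * exp (- c * t\<^sup>2 / 2) / pi) * indicator {..0} t \<partial>lborel) =
        ennreal \<bar>- 1\<bar> * (\<integral>\<^sup>+t. ennreal (- (0 + (- 1) * t) * exp (- c * (0 + (- 1) * t)\<^sup>2 / 2) / pi) *
          indicator {..0} (0 + (- 1) * t) \<partial>lborel)"
      by (rule nn_integral_real_affine) auto
    also have "\<dots> = (\<integral>\<^sup>+t. ennreal (t * exp (- c * t\<^sup>2 / 2) / pi) * indicator {0..} t \<partial>lborel)"
      by (simp, intro nn_integral_cong) (auto simp: indicator_def)
    also have "\<dots> = ennreal (0 - (- 1 / (pi * c) * exp (- c * 0\<^sup>2 / 2)))"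
    proof (rule nn_integral_FTC_atLeast)
      show "((\<lambda>t. - 1 / (pi * c) * exp (- c * t\<^sup>2 / 2)) has_real_derivative
          t * exp (- c * t\<^sup>2 / 2) / pi) (at t)" for t
        using pos by (auto intro!: derivative_eq_intros simp: field_simps)
      have "filterlim (\<lambda>t::real. - c * t\<^sup>2 / 2) at_bot at_top"
        using pos by real_asymp
      then have "((\<lambda>t::real. exp (- c * t\<^sup>2 / 2)) \<longlongrightarrow> 0) at_top"
        by (rule filterlim_compose[OF exp_at_bot])
      from tendsto_mult_left[OF this, of "- 1 / (pi * c)"]
      show "((\<lambda>t. - 1 / (pi * c) * exp (- c * t\<^sup>2 / 2)) \<longlongrightarrow> 0) at_top"
        by simp
    qed auto
    finally show ?thesis by simp
  qed
  have "(\<integral>\<^sup>+t. ennreal (2 * (phi t * Phi (l * t))) * indicator {..0} t \<partial>lborel) =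
      (\<integral>\<^sup>+t. \<integral>\<^sup>+w. ennreal (- t * exp (- (1 + w\<^sup>2) * t\<^sup>2 / 2) / pi) * indicator {l..} w * indicator {..0} t \<partial>lborel \<partial>lborel)"
    by (intro nn_integral_cong_AE eventually_mono[OF AE_lborel_singleton[of 0]] inner)
  also have "\<dots> = (\<integral>\<^sup>+w. \<integral>\<^sup>+t. ennreal (- t * exp (- (1 + w\<^sup>2) * t\<^sup>2 / 2) / pi) * indicator {l..} w * indicator {..0} t \<partial>lborel \<partial>lborel)"
    by (rule lborel_pair.Fubini') measurable
  also have "\<dots> = (\<integral>\<^sup>+w. \<integral>\<^sup>+t. (ennreal (- t * exp (- (1 + w\<^sup>2) * t\<^sup>2 / 2) / pi) * indicator {..0} t) * indicator {l..} w \<partial>lborel \<partial>lborel)"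
    by (simp add: mult_ac)
  \<comment> \<open>What remains is the Cauchy density, the law of the ratio of two independent
    standard normal variables, integrated over its tail from \<open>l\<close>.\<close>
  also have "\<dots> = (\<integral>\<^sup>+w. ennreal (1 / (pi * (1 + w\<^sup>2))) * indicator {l..} w \<partial>lborel)"
    by (subst nn_integral_multc, measurable) (simp only: outer add_pos_nonneg zero_less_one zero_le_power2)
  also have "\<dots> = ennreal (1 / pi * (pi / 2) - 1 / pi * arctan l)"
  proof (rule nn_integral_FTC_atLeast)
    show "((\<lambda>w. 1 / pi * arctan w) has_real_derivative 1 / (pi * (1 + w\<^sup>2))) (at w)" for w
      by (rule DERIV_cong[OF DERIV_cmult[OF DERIV_arctan]]) (simp add: inverse_eq_divide)
    show "((\<lambda>w. 1 / pi * arctan w) \<longlongrightarrow> 1 / pi * (pi / 2)) at_top"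
      by (intro tendsto_intros tendsto_arctan_at_top)
  qed (auto simp: add_nonneg_nonneg)
  finally have "(\<integral>\<^sup>+t. ennreal (2 * (phi t * Phi (l * t))) * indicator {..0} t \<partial>lborel) =
    ennreal (1/2 - arctan l / pi)" by simp
  moreover have "arctan l / pi \<le> 1/2"
    using arctan_ubound[of l] by (simp add: field_simps)
  ultimately show ?thesis
    by (simp add: set_lebesgue_integral_eq_nn_integral less_imp_le del: set_integral_mult_right)
qed

text \<open>Half-angle formula: 2 arctan (lam rho) is arccos rho, that is, pi/2 - arcsin
  rho.\<close>

lemma arctan_lam:
  assumes "0 \<le> \<rho>" "\<rho> < 1"
  shows "1/2 - arctan (lam \<rho>) / pi = 1/4 * (1 + 2 / pi * arcsin \<rho>)"
proof -
  define \<theta> where "\<theta> = pi / 2 - 2 * arctan (lam \<rho>)"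
  have l: "0 < lam \<rho>" "lam \<rho> \<le> 1" using assms by (auto simp: lam_def)
  have "arctan (lam \<rho>) \<le> pi / 4" using arctan_monotone'[OF l(2)] by (simp add: arctan_one)
  moreover have "0 < arctan (lam \<rho>)" using l by simp
  moreover have "0 < pi" by simp
  ultimately have "- (pi / 2) \<le> \<theta>" "\<theta> \<le> pi / 2" by (auto simp: \<theta>_def simp del: pi_gt_zero)
  moreover have "sin \<theta> = \<rho>"
  proof -
    have "sin \<theta> = cos (2 * arctan (lam \<rho>))" by (simp add: \<theta>_def sin_diff)
    also have "\<dots> = 2 * (cos (arctan (lam \<rho>)))\<^sup>2 - 1" by (rule cos_double_cos)
    also have "(cos (arctan (lam \<rho>)))\<^sup>2 = 1 / (1 + (lam \<rho>)\<^sup>2)"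
      by (simp add: cos_arctan power_divide add_nonneg_nonneg)
    also have "(lam \<rho>)\<^sup>2 = (1 - \<rho>) / (1 + \<rho>)" using assms by (simp add: lam_def)
    also have "2 * (1 / (1 + (1 - \<rho>) / (1 + \<rho>))) - 1 = \<rho>"
      using assms by (simp add: field_simps)
    finally show ?thesis .
  qed
  ultimately have "arcsin \<rho> = \<theta>" by (metis arcsin_sin)
  then have "2 / pi * arcsin \<rho> = 1 - 4 * (arctan (lam \<rho>) / pi)"
    by (simp add: \<theta>_def right_diff_distrib)
  then show ?thesis by simp
qed

subsection \<open>Bounds on the diagonal of the copula\<close>

text \<open>The third identity evaluates the limit at -inf of the derivative quotient and so
  produces the constant of (U).\<close>

lemma lam_bounds:
  assumes "0 \<le> \<rho>" "\<rho> < 1"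
  shows "0 < lam \<rho>" "lam \<rho> \<le> 1" "(1 + lam \<rho> * lam \<rho>) / 2 = 1 / (1 + \<rho>)"
proof -
  show "0 < lam \<rho>" "lam \<rho> \<le> 1" using assms by (auto simp: lam_def)
  have "lam \<rho> * lam \<rho> = (1 - \<rho>) / (1 + \<rho>)" using assms by (simp add: lam_def)
  then show "(1 + lam \<rho> * lam \<rho>) / 2 = 1 / (1 + \<rho>)" using assms by (simp add: field_simps)
qed

lemma bvn_cdf_diagonal_deriv:
  assumes "\<bar>\<rho>\<bar> < 1"
  shows "((\<lambda>h. bvn_cdf h h \<rho>) has_real_derivative 2 * (phi h * Phi (lam \<rho> * h))) (at h)"
  unfolding bvn_cdf_diagonal[OF assms]
proof (rule lower_integral_has_derivative)
  show "integrable lborel (\<lambda>h. 2 * (phi h * Phi (lam \<rho> * h)))"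
    by (intro integrable_mult_right integrable_phi_times_Phi) measurable
  show "continuous_on UNIV (\<lambda>h. 2 * (phi h * Phi (lam \<rho> * h)))"
  proof -
    have "continuous_on UNIV (\<lambda>h. Phi (lam \<rho> * h))"
      by (rule continuous_on_compose2[OF continuous_on_Phi[of UNIV]]) (auto intro: continuous_intros)
    then show ?thesis
      by (intro continuous_on_mult continuous_on_const continuous_on_phi)
  qed
qed

lemma bvn_cdf_diagonal_at_bot:
  assumes "\<bar>\<rho>\<bar> < 1"
  shows "((\<lambda>h. bvn_cdf h h \<rho>) \<longlongrightarrow> 0) at_bot"
  by (rule tendsto_sandwich[where f = "\<lambda>_. 0" and h = Phi])
    (use bvn_cdf_nonneg_le_Phi[OF assms] Phi_at_bot in auto)

text \<open>For l = \<open>lam\<close> rho the last factor is the derivative of the diagonal of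
  \<open>bvn_cdf\<close>; the product form is the one that the monotone rule expects.\<close>

lemma Phi_product_deriv:
  "((\<lambda>h. Phi h * Phi (l * h)) has_real_derivative
    (1 + l * (mills h / mills (l * h))) / 2 * (2 * (phi h * Phi (l * h)))) (at h)"
proof -
  have "((\<lambda>h. Phi h * Phi (l * h)) has_real_derivative
      phi h * Phi (l * h) + l * (Phi h * phi (l * h))) (at h)"
    by (auto intro!: derivative_eq_intros)
  moreover have "mills h / mills (l * h) * (phi h * Phi (l * h)) = Phi h * phi (l * h)"
    by (simp add: mills_def less_imp_neq[OF phi_pos, symmetric] less_imp_neq[OF Phi_pos, symmetric])
  moreover have "(1 + l * q) / 2 * (2 * c) = c + l * (q * c)" for q c :: real
    by (simp add: algebra_simps)
  ultimately show ?thesis by (simp only:)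
qed

lemma Phi_product_at_bot:
  assumes "0 < l"
  shows "((\<lambda>h. Phi h * Phi (l * h)) \<longlongrightarrow> 0) at_bot"
proof -
  have "filterlim (\<lambda>h. l * h) at_bot at_bot" using assms by real_asymp
  from tendsto_mult[OF Phi_at_bot filterlim_compose[OF Phi_at_bot this]] show ?thesis by simp
qed

lemma bvn_cdf_zero:
  assumes "0 \<le> \<rho>" "\<rho> < 1"
  shows "bvn_cdf 0 0 \<rho> = 1/4 * (1 + 2 / pi * arcsin \<rho>)"
proof -
  have "\<bar>\<rho>\<bar> < 1" using assms by simp
  then show ?thesis
    using wedge_probability[of "lam \<rho>"] arctan_lam[OF assms] lam_bounds[OF assms]
    by (simp add: bvn_cdf_diagonal)
qed

lemma bvn_cdf_diagonal_lower:
  assumes \<rho>: "0 \<le> \<rho>" "\<rho> < 1" and "h \<le> 0"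
  shows "Phi h * Phi (lam \<rho> * h) * (1 + 2 / pi * arcsin \<rho>) \<le> bvn_cdf h h \<rho>"
proof -
  let ?C = "\<lambda>h. bvn_cdf h h \<rho>" and ?N = "\<lambda>h. Phi h * Phi (lam \<rho> * h)"
  note l = lam_bounds[OF \<rho>]
  have abs: "\<bar>\<rho>\<bar> < 1" using \<rho> by simp
  \<comment> \<open>At 0 the numerator is 1/4, so the right side is the reciprocal of the constant
    in (L).\<close>
  have "?N h / ?C h \<le> ?N 0 / ?C 0"
  proof (rule quotient_mono_of_deriv_quotient_mono[where b = 0 and f = ?N and g = ?C])
    show "(?N has_real_derivative (1 + lam \<rho> * (mills x / mills (lam \<rho> * x))) / 2 *
        (2 * (phi x * Phi (lam \<rho> * x)))) (at x)" for x
      by (rule Phi_product_deriv)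
    show "(1 + lam \<rho> * (mills x / mills (lam \<rho> * x))) / 2 \<le>
        (1 + lam \<rho> * (mills y / mills (lam \<rho> * y))) / 2" if "x \<le> y" "y \<le> 0" for x y
      by (intro divide_right_mono add_left_mono mult_left_mono mills_ratio_mono) (use l that in auto)
  qed (use assms l in \<open>simp_all add: bvn_cdf_diagonal_deriv[OF abs] Phi_product_at_bot
      bvn_cdf_diagonal_at_bot[OF abs]\<close>)
  moreover have "0 \<le> arcsin \<rho>" using \<rho> by (simp add: arcsin_nonneg)
  then have "0 < 1 + 2 / pi * arcsin \<rho>" by (simp add: add_pos_nonneg)
  moreover have "0 < ?C h"
    by (rule DERIV_pos_imp_increasing_at_bot[where f = ?C])
      (auto intro!: exI[of _ "2 * (phi x * Phi (lam \<rho> * x))" for x] bvn_cdf_diagonal_deriv[OF abs]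
        bvn_cdf_diagonal_at_bot[OF abs])
  ultimately show ?thesis
    by (simp add: bvn_cdf_zero[OF \<rho>] Phi_0 divide_simps mult_ac)
qed

text \<open>An increasing function stays above its limit at -inf, which is \<open>lam\<close> rho
  for the ratio of the \<open>mills\<close> values.\<close>

lemma mills_ratio_bound:
  assumes "0 \<le> \<rho>" "\<rho> < 1" and "t \<le> 0"
  shows "1 / (1 + \<rho>) \<le> (1 + lam \<rho> * (mills t / mills (lam \<rho> * t))) / 2"
proof -
  note l = lam_bounds[OF assms(1,2)]
  have "lam \<rho> \<le> mills t / mills (lam \<rho> * t)"
  proof (rule tendsto_upperbound[OF mills_ratio_at_bot[OF l(1)]])
    show "\<forall>\<^sub>F s in at_bot. mills s / mills (lam \<rho> * s) \<le> mills t / mills (lam \<rho> * t)"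
      using mills_ratio_mono[OF l(1,2) _ \<open>t \<le> 0\<close>] unfolding eventually_at_bot_linorder by blast
  qed simp
  then have "(1 + lam \<rho> * lam \<rho>) / 2 \<le> (1 + lam \<rho> * (mills t / mills (lam \<rho> * t))) / 2"
    by (intro divide_right_mono add_left_mono mult_left_mono) (use l(1) in auto)
  moreover have "(1 + lam \<rho> * lam \<rho>) / 2 = 1 / (1 + \<rho>)"
    by (rule l(3))
  ultimately show ?thesis by simp
qed

text \<open>Instead of passing to the limit in the quotient, the lower bound on the derivative
  quotient is integrated from -inf.\<close>

lemma bvn_cdf_diagonal_upper:
  assumes \<rho>: "0 \<le> \<rho>" "\<rho> < 1" and "h \<le> 0"
  shows "bvn_cdf h h \<rho> \<le> Phi h * Phi (lam \<rho> * h) * (1 + \<rho>)"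
proof -
  let ?C = "\<lambda>h. bvn_cdf h h \<rho>" and ?N = "\<lambda>h. Phi h * Phi (lam \<rho> * h)"
  let ?c = "\<lambda>x. 2 * (phi x * Phi (lam \<rho> * x))"
  let ?r = "\<lambda>x. (1 + lam \<rho> * (mills x / mills (lam \<rho> * x))) / 2"
  note l = lam_bounds[OF \<rho>]
  have abs: "\<bar>\<rho>\<bar> < 1" using \<rho> by simp
  have "0 \<le> ?N h - 1 / (1 + \<rho>) * ?C h"
  proof (rule nondecreasing_at_bot_limit_le
      [where f = "\<lambda>h. ?N h - 1 / (1 + \<rho>) * ?C h" and f' = "\<lambda>x. ?r x * ?c x - 1 / (1 + \<rho>) * ?c x"])
    show "((\<lambda>h. ?N h - 1 / (1 + \<rho>) * ?C h) has_real_derivative ?r x * ?c x - 1 / (1 + \<rho>) * ?c x) (at x)" for x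
      by (intro DERIV_diff DERIV_cmult Phi_product_deriv bvn_cdf_diagonal_deriv abs)
    show "((\<lambda>h. ?N h - 1 / (1 + \<rho>) * ?C h) \<longlongrightarrow> 0) at_bot"
      using tendsto_diff[OF Phi_product_at_bot[OF l(1)]
          tendsto_mult_left[OF bvn_cdf_diagonal_at_bot[OF abs], of "1 / (1 + \<rho>)"]] by simp
    fix x assume "x \<le> h"
    then have "1 / (1 + \<rho>) * ?c x \<le> ?r x * ?c x"
      using assms by (intro mult_right_mono mills_ratio_bound) (auto simp: less_imp_le)
    then show "0 \<le> ?r x * ?c x - 1 / (1 + \<rho>) * ?c x" by simp
  qed
  then show ?thesis using \<rho> by (simp add: field_simps)
qed

text \<open>If a < 1 + rho, the derivative quotient times a is below 1 near -inf. Then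
  \<open>?C - ?N * a\<close> starts from 0 with a positive derivative, and the assumed bound fails
  there.\<close>

lemma bvn_cdf_diagonal_upper_optimal:
  assumes \<rho>: "0 \<le> \<rho>" "\<rho> < 1"
    and bound: "\<And>h. h \<le> 0 \<Longrightarrow> bvn_cdf h h \<rho> \<le> Phi h * Phi (lam \<rho> * h) * a"
  shows "1 + \<rho> \<le> a"
proof (rule ccontr)
  assume "\<not> 1 + \<rho> \<le> a"
  let ?C = "\<lambda>h. bvn_cdf h h \<rho>" and ?N = "\<lambda>h. Phi h * Phi (lam \<rho> * h)"
  let ?c = "\<lambda>x. 2 * (phi x * Phi (lam \<rho> * x))"
  let ?r = "\<lambda>x. (1 + lam \<rho> * (mills x / mills (lam \<rho> * x))) / 2"
  note l = lam_bounds[OF \<rho>]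
  have abs: "\<bar>\<rho>\<bar> < 1" using \<rho> by simp
  have "(?r \<longlongrightarrow> (1 + lam \<rho> * lam \<rho>) / 2) at_bot"
    by (intro tendsto_intros mills_ratio_at_bot l) simp
  moreover have "(1 + lam \<rho> * lam \<rho>) / 2 = 1 / (1 + \<rho>)"
    by (rule l(3))
  ultimately have "((\<lambda>x. ?r x * a) \<longlongrightarrow> 1 / (1 + \<rho>) * a) at_bot"
    by (metis tendsto_mult_right)
  moreover have "1 / (1 + \<rho>) * a < 1" using \<open>\<not> 1 + \<rho> \<le> a\<close> \<rho> by (simp add: divide_simps)
  ultimately have "\<forall>\<^sub>F x in at_bot. ?r x * a < 1" by (rule order_tendstoD)
  then have "\<forall>\<^sub>F x in at_bot. ?r x * a < 1 \<and> x \<le> 0"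
    by (intro eventually_conj eventually_le_at_bot)
  then obtain b where b: "\<And>x. x \<le> b \<Longrightarrow> ?r x * a < 1 \<and> x \<le> 0"
    unfolding eventually_at_bot_linorder by blast
  have "0 < ?C b - ?N b * a"
  proof (rule DERIV_pos_imp_increasing_at_bot[where f = "\<lambda>h. ?C h - ?N h * a" and b = b])
    show "((\<lambda>h. ?C h - ?N h * a) \<longlongrightarrow> 0) at_bot"
      using tendsto_diff[OF bvn_cdf_diagonal_at_bot[OF abs]
          tendsto_mult_right[OF Phi_product_at_bot[OF l(1)], of a]] by simp
    fix x assume "x \<le> b"
    have "((\<lambda>h. ?C h - ?N h * a) has_real_derivative ?c x - ?r x * ?c x * a) (at x)"
      by (intro DERIV_diff DERIV_cmult_right Phi_product_deriv bvn_cdf_diagonal_deriv abs)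
    moreover have "?r x * a * ?c x < 1 * ?c x"
      using b[OF \<open>x \<le> b\<close>] by (intro mult_strict_right_mono) auto
    then have "0 < ?c x - ?r x * ?c x * a" by (simp add: mult_ac)
    ultimately show "\<exists>y. ((\<lambda>h. ?C h - ?N h * a) has_real_derivative y) (at x) \<and> y > 0" by blast
  qed
  with bound[of b] b[of b] show False by simp
qed

section \<open>From the distribution function to the copula, with the cases u = 0 and rho =
  1\<close>

lemma bvn_copula_Phi:
  assumes "\<rho> < 1"
  shows "bvn_copula (Phi h) (Phi k) \<rho> = bvn_cdf h k \<rho>"
proof -
  have "Phi x < 1" for x using Phi_less[of x "x + 1"] Phi_le_1[of "x + 1"] by linarith
  then show ?thesis
    using assms by (simp add: bvn_copula_def bvn_copula_closed_def bvn_copula_interior_def)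
qed

lemma bvn_g_Phi: "bvn_g (Phi h) \<rho> = Phi (lam \<rho> * h)"
  by (simp add: bvn_g_def bvn_g_interior_def lam_def less_imp_neq[OF Phi_pos, symmetric])

text \<open>The corner value is a \<open>Lim\<close>, determined only because the corner is a limit
  point of the open square. There the copula is squeezed between 0 and its first argument.\<close>

lemma bvn_copula_closed_0:
  assumes "\<bar>\<rho>\<bar> < 1"
  shows "bvn_copula_closed 0 0 \<rho> = 0"
proof -
  let ?F = "at (0 :: real, 0 :: real) within {0<..<1} \<times> {0<..<1}"
  have "(0 :: real, 0 :: real) islimpt {0<..<1} \<times> {0<..<1}"
    by (simp add: islimpt_in_closure closure_Times Diff_triv)
  then have "?F \<noteq> bot" by (simp add: trivial_limit_within)
  moreover have "((\<lambda>(s, t). bvn_copula_interior s t \<rho>) \<longlongrightarrow> 0) ?F"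
  proof (rule tendsto_sandwich[where f = "\<lambda>_. 0" and h = fst])
    have *: "0 \<le> bvn_copula_interior s t \<rho>" "bvn_copula_interior s t \<rho> \<le> s" if "s \<in> {0<..<1}" for s t
    proof -
      obtain h where "Phi h = s" using ex_Phi_eq[of s] \<open>s \<in> {0<..<1}\<close> by auto
      then show "0 \<le> bvn_copula_interior s t \<rho>" "bvn_copula_interior s t \<rho> \<le> s"
        using bvn_cdf_nonneg_le_Phi[OF assms, of h "std_normal_quantile t"]
        by (auto simp: bvn_copula_interior_def)
    qed
    show "\<forall>\<^sub>F p in ?F. 0 \<le> (case p of (s, t) \<Rightarrow> bvn_copula_interior s t \<rho>)"
      "\<forall>\<^sub>F p in ?F. (case p of (s, t) \<Rightarrow> bvn_copula_interior s t \<rho>) \<le> fst p"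
      using * by (auto simp: eventually_at_filter intro!: always_eventually)
    have "(fst \<longlongrightarrow> fst (0 :: real, 0 :: real)) ?F" by (intro tendsto_intros)
    then show "(fst \<longlongrightarrow> 0) ?F" by simp
  qed simp
  ultimately have "Lim ?F (\<lambda>(s, t). bvn_copula_interior s t \<rho>) = 0" by (rule tendsto_Lim)
  then show ?thesis by (simp add: bvn_copula_closed_def)
qed

lemma bvn_copula_0:
  assumes "0 \<le> \<rho>" "\<rho> \<le> 1"
  shows "bvn_copula 0 0 \<rho> = 0"
proof (cases "\<rho> = 1")
  case True
  have "((\<lambda>r. bvn_copula_closed 0 0 r) \<longlongrightarrow> 0) (at_left 1)"
  proof (rule tendsto_eventually)
    show "\<forall>\<^sub>F r in at_left 1. bvn_copula_closed 0 0 r = 0"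
      using eventually_at_left_real[of 0 1] by (auto elim!: eventually_mono intro: bvn_copula_closed_0)
  qed
  then show ?thesis using True by (simp add: bvn_copula_def tendsto_Lim)
qed (use assms in \<open>simp add: bvn_copula_def bvn_copula_closed_0\<close>)

lemma bvn_copula_comonotone:
  assumes "h \<le> 0"
  shows "bvn_copula (Phi h) (Phi h) 1 = Phi h"
proof -
  have ev: "\<forall>\<^sub>F r in at_left 1. r \<in> {0<..<1 :: real}"
    using eventually_at_left_real[of 0 1] by simp
  have "(lam \<longlongrightarrow> lam 1) (at_left 1)"
    unfolding lam_def by (intro tendsto_intros) auto
  then have "((\<lambda>r. lam r * h) \<longlongrightarrow> lam 1 * h) (at_left 1)"
    by (rule tendsto_mult_right)
  then have "((\<lambda>r. Phi (lam r * h)) \<longlongrightarrow> Phi 0) (at_left 1)"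
    using isCont_tendsto_compose[OF DERIV_isCont[OF Phi_deriv, of 0]] by (simp add: lam_def[of 1])
  then have Phi_lim: "((\<lambda>r. Phi (lam r * h)) \<longlongrightarrow> 1/2) (at_left 1)"
    by (simp add: Phi_0)
  have "((\<lambda>r. bvn_cdf h h r) \<longlongrightarrow> Phi h) (at_left 1)"
  proof (rule tendsto_sandwich)
    show "\<forall>\<^sub>F r in at_left 1. Phi h * Phi (lam r * h) * (1 + 2 / pi * arcsin r) \<le> bvn_cdf h h r"
      by (rule eventually_mono[OF ev], rule bvn_cdf_diagonal_lower) (use assms in auto)
    show "\<forall>\<^sub>F r in at_left 1. bvn_cdf h h r \<le> Phi h * Phi (lam r * h) * (1 + r)"
      by (rule eventually_mono[OF ev], rule bvn_cdf_diagonal_upper) (use assms in auto)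
    have "((\<lambda>r. Phi h * Phi (lam r * h) * (1 + r)) \<longlongrightarrow> Phi h * (1/2) * (1 + 1)) (at_left 1)"
      by (intro tendsto_intros Phi_lim)
    then show "((\<lambda>r. Phi h * Phi (lam r * h) * (1 + r)) \<longlongrightarrow> Phi h) (at_left 1)" by simp
    \<comment> \<open>At 1 the arcsine is continuous only from within its domain, so its limit is
      taken in an interval ending at 1 and then read as a left limit.\<close>
    have "((arcsin \<longlongrightarrow> arcsin 1) (at 1 within {-1..1 :: real}))"
      using continuous_on_arcsin' unfolding continuous_on_def by (rule bspec) simp
    then have "(arcsin \<longlongrightarrow> arcsin 1) (at 1 within {0..1})"
      by (rule tendsto_within_subset) auto
    then have "(arcsin \<longlongrightarrow> pi / 2) (at_left 1)"
      by (simp add: at_within_Icc_at_left)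
    then have "((\<lambda>r. Phi h * Phi (lam r * h) * (1 + 2 / pi * arcsin r)) \<longlongrightarrow>
        Phi h * (1/2) * (1 + 2 / pi * (pi / 2))) (at_left 1)"
      by (intro tendsto_intros Phi_lim)
    then show "((\<lambda>r. Phi h * Phi (lam r * h) * (1 + 2 / pi * arcsin r)) \<longlongrightarrow> Phi h) (at_left 1)"
      by simp
  qed
  moreover have "\<forall>\<^sub>F r in at_left 1. bvn_cdf h h r = bvn_copula_closed (Phi h) (Phi h) r"
    using ev by eventually_elim (metis bvn_copula_Phi bvn_copula_def greaterThanLessThan_iff less_irrefl)
  ultimately have "((\<lambda>r. bvn_copula_closed (Phi h) (Phi h) r) \<longlongrightarrow> Phi h) (at_left 1)"
    by (rule Lim_transform_eventually)
  then show ?thesis by (simp add: bvn_copula_def tendsto_Lim)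
qed

lemma bvn_copula_bounds:
  assumes "0 \<le> \<rho>" "\<rho> \<le> 1" "0 \<le> u" "u \<le> 1/2"
  shows "u * bvn_g u \<rho> * (1 + 2 / pi * arcsin \<rho>) \<le> bvn_copula u u \<rho>"
    and "bvn_copula u u \<rho> \<le> u * bvn_g u \<rho> * (1 + \<rho>)"
proof -
  have "u * bvn_g u \<rho> * (1 + 2 / pi * arcsin \<rho>) \<le> bvn_copula u u \<rho> \<and>
      bvn_copula u u \<rho> \<le> u * bvn_g u \<rho> * (1 + \<rho>)"
  proof (cases "u = 0")
    case True
    then show ?thesis using assms by (simp add: bvn_copula_0)
  next
    case False
    then obtain h where h: "h \<le> 0" "u = Phi h" using half_Phi_cases[of u] assms by auto
    show ?thesis
    proof (cases "\<rho> = 1")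
      case True
      then show ?thesis using h by (simp add: bvn_copula_comonotone bvn_g_Phi lam_def Phi_0)
    next
      case False
      then show ?thesis
        using assms h bvn_cdf_diagonal_lower[of \<rho> h] bvn_cdf_diagonal_upper[of \<rho> h]
        by (simp add: bvn_copula_Phi bvn_g_Phi)
    qed
  qed
  then show "u * bvn_g u \<rho> * (1 + 2 / pi * arcsin \<rho>) \<le> bvn_copula u u \<rho>"
    and "bvn_copula u u \<rho> \<le> u * bvn_g u \<rho> * (1 + \<rho>)" by auto
qed

lemma bvn_g_half: "bvn_g (1/2) \<rho> = 1/2"
  using bvn_g_Phi[of 0 \<rho>] by (simp add: Phi_0)

lemma bvn_copula_half:
  assumes "0 \<le> \<rho>" "\<rho> \<le> 1"
  shows "bvn_copula (1/2) (1/2) \<rho> = 1/4 * (1 + 2 / pi * arcsin \<rho>)"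
proof (cases "\<rho> = 1")
  case True
  then show ?thesis using bvn_copula_comonotone[of 0] by (simp add: Phi_0)
next
  case False
  then show ?thesis
    using assms bvn_copula_Phi[of \<rho> 0 0] bvn_cdf_zero[of \<rho>] by (simp add: Phi_0)
qed

lemma bvn_g_pos_le_half:
  assumes "0 \<le> \<rho>" "\<rho> \<le> 1" "0 < u" "u \<le> 1/2"
  shows "0 < bvn_g u \<rho>" "bvn_g u \<rho> \<le> 1/2"
proof -
  obtain h where h: "h \<le> 0" "u = Phi h" using half_Phi_cases[of u] assms by auto
  moreover have "0 \<le> lam \<rho>" using assms by (simp add: lam_def)
  ultimately show "0 < bvn_g u \<rho>" "bvn_g u \<rho> \<le> 1/2"
    using Phi_mono[of "lam \<rho> * h" 0] by (auto simp: bvn_g_Phi Phi_0 mult_nonneg_nonpos)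
qed

text \<open>The derivative cos t - cos s changes from nonnegative to nonpositive at t = s, since
  cosine decreases on [0, pi]. With cos s = 2/pi this maximises rho - (2/pi) arcsin rho for rho =
  sin t.\<close>

lemma sin_tangent_bound:
  fixes s t :: real
  assumes "s \<in> {0..pi}" "t \<in> {0..pi}"
  shows "sin t - cos s * t \<le> sin s - cos s * s"
proof -
  have deriv: "((\<lambda>t. sin t - cos s * t) has_real_derivative cos x - cos s) (at x)" for x
    by (auto intro!: derivative_eq_intros)
  show ?thesis
  proof (cases "t \<le> s")
    case True
    show ?thesis
      by (rule DERIV_nonneg_imp_nondecreasing[OF True])
        (use assms in \<open>auto intro!: exI[of _ "cos x - cos s" for x] deriv cos_monotone_0_pi_le\<close>)
  next
    case False
    then show ?thesis
      by (intro DERIV_nonpos_imp_nonincreasing[of s t])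
        (use assms in \<open>auto intro!: exI[of _ "cos x - cos s" for x] deriv cos_monotone_0_pi_le\<close>)
  qed
qed

subsection \<open>Numerical bounds and the maximal error\<close>

lemma two_over_pi_bounds: "0.6366197723 \<le> 2 / pi" "2 / pi \<le> 0.6366197724"
  using pi_approx by (simp_all add: le_divide_eq divide_le_eq)

lemma two_over_pi_le_1: "2 / pi \<le> 1" "- 1 \<le> 2 / pi"
  using pi_gt3 by (auto simp: divide_le_eq intro: order_trans[of _ 0])

text \<open>Near 0.88 the remainder x^10 / 10! is below 1e-7, much finer than the enclosure of
  arccos (2/pi) requires.\<close>

lemma cos_Taylor_10:
  fixes x :: real
  shows "1 - x^2/2 + x^4/24 - x^6/720 + x^8/40320 - x^10 / 3628800 \<le> cos x"
    and "cos x \<le> 1 - x^2/2 + x^4/24 - x^6/720 + x^8/40320 + x^10 / 3628800"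
proof -
  obtain t where t: "cos x = (\<Sum>m<10. cos_coeff m * x ^ m) + (cos (t + 1/2 * real 10 * pi) / fact 10) * x ^ 10"
    using Maclaurin_cos_expansion[of x 10] by blast
  have sum: "(\<Sum>m<10. cos_coeff m * x ^ m) = 1 - x^2/2 + x^4/24 - x^6/720 + x^8/40320"
    by (simp add: lessThan_nat_numeral lessThan_Suc cos_coeff_def fact_numeral)
  define c where "c = cos (t + 1/2 * real 10 * pi)"
  have "\<bar>c\<bar> \<le> 1" by (simp add: c_def)
  have "cos x - (1 - x^2/2 + x^4/24 - x^6/720 + x^8/40320) = c * (x ^ 10 / 3628800)"
    unfolding t sum c_def[symmetric] by (simp add: fact_numeral)
  also have "\<bar>\<dots>\<bar> \<le> x ^ 10 / 3628800"
    using mult_right_mono[OF \<open>\<bar>c\<bar> \<le> 1\<close>, of "\<bar>x ^ 10 / 3628800\<bar>"] by (simp add: abs_mult)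
  finally show "1 - x^2/2 + x^4/24 - x^6/720 + x^8/40320 - x^10 / 3628800 \<le> cos x"
    and "cos x \<le> 1 - x^2/2 + x^4/24 - x^6/720 + x^8/40320 + x^10 / 3628800"
    by linarith+
qed

text \<open>Comparing cosines at two decimals encloses the angle. The width 1.2e-5 is scaled by 1/4
  * 2/pi in the maximal error, which leaves less than 2e-6.\<close>

lemma arccos_two_over_pi: "0.880683 \<le> arccos (2 / pi)" "arccos (2 / pi) \<le> 0.880695"
proof -
  note le = two_over_pi_le_1
  have arccos: "arccos (cos x) = x" if "0 \<le> x" "x \<le> 1" for x
    using that pi_gt3 by (intro arccos_cos) auto
  have "0.6366197724 \<le> cos (0.880683 :: real)"
    using cos_Taylor_10(1)[of "0.880683"] by (simp add: power_divide)
  with two_over_pi_bounds(2) have "2 / pi \<le> cos 0.880683" by (rule order_trans)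
  then have "arccos (cos 0.880683) \<le> arccos (2 / pi)"
    by (intro arccos_le_mono[THEN iffD2]) (use le in auto)
  then show "0.880683 \<le> arccos (2 / pi)" by (simp add: arccos)
  have "cos (0.880695 :: real) \<le> 0.6366197723"
    using cos_Taylor_10(2)[of "0.880695"] by (simp add: power_divide)
  from this two_over_pi_bounds(1) have "cos 0.880695 \<le> 2 / pi" by (rule order_trans)
  then have "arccos (2 / pi) \<le> arccos (cos 0.880695)"
    by (intro arccos_le_mono[THEN iffD2]) (use le in auto)
  then show "arccos (2 / pi) \<le> 0.880695" by (simp add: arccos)
qed

text \<open>The derivative 1 - (2/pi) / sqrt (1 - rho^2) of rho - (2/pi) arcsin rho vanishes at this
  value, the sine of the angle with cosine 2/pi.\<close>

lemma sqrt_one_minus_four_over_pi_sq: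
  "sqrt (1 - 4 / pi\<^sup>2) = sin (arccos (2 / pi))"
  "0.771177 \<le> sqrt (1 - 4 / pi\<^sup>2)" "sqrt (1 - 4 / pi\<^sup>2) \<le> 0.771179"
proof -
  have sq: "4 / pi\<^sup>2 = (2 / pi)\<^sup>2" by (simp add: power_divide)
  show "sqrt (1 - 4 / pi\<^sup>2) = sin (arccos (2 / pi))"
    unfolding sq by (rule sin_arccos[OF two_over_pi_le_1(2,1), symmetric])
  have b: "0.6366197723\<^sup>2 \<le> (2 / pi)\<^sup>2" "(2 / pi)\<^sup>2 \<le> 0.6366197724\<^sup>2"
    using two_over_pi_bounds by (intro power_mono; simp)+
  have "0.771177\<^sup>2 \<le> 1 - (0.6366197724 :: real)\<^sup>2" "1 - (0.6366197723 :: real)\<^sup>2 \<le> 0.771179\<^sup>2"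
    by (simp_all add: power2_eq_square)
  with b have *: "0.771177\<^sup>2 \<le> 1 - (2 / pi)\<^sup>2" "1 - (2 / pi)\<^sup>2 \<le> 0.771179\<^sup>2"
    by linarith+
  show "0.771177 \<le> sqrt (1 - 4 / pi\<^sup>2)" unfolding sq by (rule real_le_rsqrt[OF *(1)])
  show "sqrt (1 - 4 / pi\<^sup>2) \<le> 0.771179" unfolding sq by (rule real_le_lsqrt[OF _ *(2)]) simp
qed

lemma bvn_upper_error_le:
  fixes \<rho>0 :: real
  defines "\<rho>0 \<equiv> sqrt (1 - 4 / pi\<^sup>2)"
  assumes "0 \<le> \<rho>" "\<rho> \<le> 1" "0 \<le> u" "u \<le> 1/2"
  shows "u * bvn_g u \<rho> * (1 + \<rho>) - bvn_copula u u \<rho> \<le> 1/4 * (\<rho>0 - 2 / pi * arcsin \<rho>0)"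
proof -
  define e where "e r = r - 2 / pi * arcsin r" for r
  define \<theta> where "\<theta> = arccos (2 / pi)"
  have \<theta>: "0 \<le> \<theta>" "\<theta> \<le> pi / 2" "cos \<theta> = 2 / pi"
    unfolding \<theta>_def
    by (rule arccos_lbound arccos_le_pi2 cos_arccos two_over_pi_le_1 divide_nonneg_nonneg | simp)+
  have \<rho>0: "\<rho>0 = sin \<theta>" "arcsin \<rho>0 = \<theta>"
    using sqrt_one_minus_four_over_pi_sq(1) \<theta> by (auto simp: \<rho>0_def \<theta>_def[symmetric] arcsin_sin)
  have arcsin: "0 \<le> arcsin \<rho>" "arcsin \<rho> \<le> pi / 2" "sin (arcsin \<rho>) = \<rho>"
    using assms(2,3) arcsin_ubound[of \<rho>] by (auto simp: arcsin_nonneg)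
  have e_max: "e \<rho> \<le> e \<rho>0"
    using sin_tangent_bound[of \<theta> "arcsin \<rho>"] \<theta> arcsin pi_gt_zero unfolding e_def \<rho>0(2) by (auto simp: \<rho>0(1))
  \<comment> \<open>Read off from (U) at u = 1/2, where the copula is known exactly. The sign is
    needed to replace \<open>u\<close> and \<open>bvn_g u rho\<close> by their upper bounds
    1/2.\<close>
  have e_nonneg: "0 \<le> e \<rho>"
    using bvn_copula_bounds(2)[OF assms(2,3), of "1/2"] bvn_copula_half[OF assms(2,3)]
    by (simp add: bvn_g_half e_def)
  show ?thesis
  proof (cases "u = 0")
    case True
    then show ?thesis
      using e_max e_nonneg assms bvn_copula_0[OF assms(2,3)] by (simp add: e_def)
  next
    case False
    note g = bvn_g_pos_le_half[OF assms(2,3) _ assms(5)]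
    have "u * bvn_g u \<rho> * (1 + \<rho>) - bvn_copula u u \<rho> \<le> u * bvn_g u \<rho> * e \<rho>"
      using bvn_copula_bounds(1)[OF assms(2-5)] by (simp add: e_def algebra_simps)
    also have "\<dots> \<le> 1/2 * (1/2) * e \<rho>"
      using assms False g e_nonneg by (intro mult_mono mult_nonneg_nonneg) auto
    also have "\<dots> \<le> 1/4 * e \<rho>0" using e_max by simp
    finally show ?thesis by (simp add: e_def)
  qed
qed

lemma bvn_upper_error_at_half:
  assumes "0 \<le> \<rho>" "\<rho> \<le> 1"
  shows "1/2 * bvn_g (1/2) \<rho> * (1 + \<rho>) - bvn_copula (1/2) (1/2) \<rho> = 1/4 * (\<rho> - 2 / pi * arcsin \<rho>)"
  by (simp add: bvn_copula_half[OF assms] bvn_g_half add_divide_distrib)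

text \<open>The single point u = 1/2, where (L) is an equality, forces the constant.\<close>

lemma bvn_copula_lower_optimal:
  assumes "0 \<le> \<rho>" "\<rho> \<le> 1"
    and "\<And>u. 0 \<le> u \<Longrightarrow> u \<le> 1/2 \<Longrightarrow> u * bvn_g u \<rho> * a \<le> bvn_copula u u \<rho>"
  shows "a \<le> 1 + 2 / pi * arcsin \<rho>"
  using assms(3)[of "1/2"] bvn_copula_half[OF assms(1,2)] by (simp add: bvn_g_half)

text \<open>For rho < 1 the constant is forced by the behaviour as u tends to 0; for rho = 1 the
  point u = 1/2 suffices.\<close>

lemma bvn_copula_upper_optimal:
  assumes "0 \<le> \<rho>" "\<rho> \<le> 1"
    and bound: "\<And>u. 0 \<le> u \<Longrightarrow> u \<le> 1/2 \<Longrightarrow> bvn_copula u u \<rho> \<le> u * bvn_g u \<rho> * a"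
  shows "1 + \<rho> \<le> a"
proof (cases "\<rho> = 1")
  case True
  then show ?thesis
    using bound[of "1/2"] bvn_copula_half[of 1] by (simp add: bvn_g_half)
next
  case False
  show ?thesis
  proof (rule bvn_cdf_diagonal_upper_optimal)
    show "bvn_cdf h h \<rho> \<le> Phi h * Phi (lam \<rho> * h) * a" if "h \<le> 0" for h
      using bound[of "Phi h"] Phi_mono[OF that] False assms(2)
      by (simp add: bvn_copula_Phi bvn_g_Phi Phi_0 less_imp_le)
  qed (use assms False in auto)
qed

lemma rho0_numerics:
  fixes \<rho>0 :: real
  defines "\<rho>0 \<equiv> sqrt (1 - 4 / pi\<^sup>2)"
  shows "\<bar>\<rho>0 - 0.7712\<bar> \<le> 0.00005" "\<bar>1/4 * (\<rho>0 - 2 / pi * arcsin \<rho>0) - 0.05263\<bar> \<le> 0.000005"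
proof -
  note b = sqrt_one_minus_four_over_pi_sq(2,3)[folded \<rho>0_def]
  show "\<bar>\<rho>0 - 0.7712\<bar> \<le> 0.00005" using b by (simp add: abs_le_iff)
  define \<theta> where "\<theta> = arccos (2 / pi)"
  have \<theta>: "0.880683 \<le> \<theta>" "\<theta> \<le> 0.880695" using arccos_two_over_pi by (auto simp: \<theta>_def)
  have "arcsin \<rho>0 = \<theta>"
    using sqrt_one_minus_four_over_pi_sq(1) \<theta> pi_gt3
    by (auto simp: \<rho>0_def \<theta>_def[symmetric] intro!: arcsin_sin)
  define q where "q = 2 / pi * \<theta>"
  have "0.6366197723 * 0.880683 \<le> q" "q \<le> 0.6366197724 * 0.880695"
    unfolding q_def using two_over_pi_bounds \<theta> by (intro mult_mono; simp)+
  then have "\<bar>1/4 * (\<rho>0 - q) - 0.05263\<bar> \<le> 0.000005"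
    using b unfolding abs_le_iff by simp
  then show "\<bar>1/4 * (\<rho>0 - 2 / pi * arcsin \<rho>0) - 0.05263\<bar> \<le> 0.000005"
    by (simp only: q_def \<open>arcsin \<rho>0 = \<theta>\<close>)
qed

theorem theorem5p2:
  shows
    "(\<forall>\<rho>\<in>{0<..1}. \<forall>u\<in>{0..1/2}.
        bvn_copula u u \<rho> \<ge> u * bvn_g u \<rho> * (1 + 2 / pi * arcsin \<rho>) \<and>
        bvn_copula u u \<rho> \<le> u * bvn_g u \<rho> * (1 + \<rho>)) \<and>
     (\<forall>\<rho>\<in>{0<..1}. \<forall>a::real.
        (\<forall>u\<in>{0..1/2}. bvn_copula u u \<rho> \<ge> u * bvn_g u \<rho> * a) \<longrightarrow> a \<le> 1 + 2 / pi * arcsin \<rho>) \<and>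
     (\<forall>\<rho>\<in>{0<..1}. \<forall>a::real.
        (\<forall>u\<in>{0..1/2}. bvn_copula u u \<rho> \<le> u * bvn_g u \<rho> * a) \<longrightarrow> a \<ge> 1 + \<rho>) \<and>
     (\<forall>\<rho>\<in>{0..1}. \<forall>u\<in>{0..1/2}. \<rho> = 0 \<or> \<rho> = 1 \<or> u = 0 \<longrightarrow>
        bvn_copula u u \<rho> = u * bvn_g u \<rho> * (1 + 2 / pi * arcsin \<rho>) \<and>
        bvn_copula u u \<rho> = u * bvn_g u \<rho> * (1 + \<rho>)) \<and>
     (let \<rho>0 = sqrt (1 - 4 / pi\<^sup>2) in
       \<rho>0 \<in> {0<..1} \<and>
       (\<forall>\<rho>\<in>{0<..1}. \<forall>u\<in>{0..1/2}.
          u * bvn_g u \<rho> * (1 + \<rho>) - bvn_copula u u \<rho>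
            \<le> 1/2 * bvn_g (1/2) \<rho>0 * (1 + \<rho>0) - bvn_copula (1/2) (1/2) \<rho>0) \<and>
       1/2 * bvn_g (1/2) \<rho>0 * (1 + \<rho>0) - bvn_copula (1/2) (1/2) \<rho>0
         = 1/4 * (\<rho>0 - 2 / pi * arcsin \<rho>0) \<and>
       \<bar>\<rho>0 - 0.7712\<bar> \<le> 0.00005 \<and>
       \<bar>1/4 * (\<rho>0 - 2 / pi * arcsin \<rho>0) - 0.05263\<bar> \<le> 0.000005) \<and>
     (\<forall>\<rho>\<in>{0<..1}.
        bvn_copula (1/2) (1/2) \<rho> = 1/2 * bvn_g (1/2) \<rho> * (1 + 2 / pi * arcsin \<rho>))"
proof -
  define \<rho>0 where "\<rho>0 = sqrt (1 - 4 / pi\<^sup>2)"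
  have \<rho>0: "0 < \<rho>0" "\<rho>0 \<le> 1"
    using sqrt_one_minus_four_over_pi_sq(2,3)[folded \<rho>0_def] by simp_all
  \<comment> \<open>In each of the three cases the bounds (L) and (U) have the same value, which
    leaves no room for the copula.\<close>
  have tight: "bvn_copula u u \<rho> = u * bvn_g u \<rho> * (1 + 2 / pi * arcsin \<rho>) \<and>
      bvn_copula u u \<rho> = u * bvn_g u \<rho> * (1 + \<rho>)"
    if "\<rho> \<in> {0..1}" "u \<in> {0..1/2}" "\<rho> = 0 \<or> \<rho> = 1 \<or> u = 0" for \<rho> u :: real
    using that bvn_copula_bounds[of \<rho> u] by auto
  have error: "u * bvn_g u \<rho> * (1 + \<rho>) - bvn_copula u u \<rho>
      \<le> 1/2 * bvn_g (1/2) \<rho>0 * (1 + \<rho>0) - bvn_copula (1/2) (1/2) \<rho>0"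
    if "\<rho> \<in> {0<..1}" "u \<in> {0..1/2}" for \<rho> u :: real
    using bvn_upper_error_le[of \<rho> u] bvn_upper_error_at_half[of \<rho>0] \<rho>0 that
    by (simp only: \<rho>0_def[symmetric]) auto
  have half: "bvn_copula (1/2) (1/2) \<rho> = 1/2 * bvn_g (1/2) \<rho> * (1 + 2 / pi * arcsin \<rho>)"
    if "\<rho> \<in> {0<..1}" for \<rho> :: real
    using that bvn_copula_half[of \<rho>] by (simp add: bvn_g_half)
  show ?thesis
    unfolding Let_def \<rho>0_def[symmetric]
  proof (intro conjI ballI allI impI)
    fix \<rho> a :: real
    assume \<rho>: "\<rho> \<in> {0<..1}"
    show "a \<le> 1 + 2 / pi * arcsin \<rho>" if "\<forall>u\<in>{0..1/2}. u * bvn_g u \<rho> * a \<le> bvn_copula u u \<rho>"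
      using that \<rho> by (intro bvn_copula_lower_optimal) auto
    show "1 + \<rho> \<le> a" if "\<forall>u\<in>{0..1/2}. bvn_copula u u \<rho> \<le> u * bvn_g u \<rho> * a"
      using that \<rho> by (intro bvn_copula_upper_optimal) auto
  next
    show "u * bvn_g u \<rho> * (1 + \<rho>) - bvn_copula u u \<rho>
        \<le> 1/2 * bvn_g (1/2) \<rho>0 * (1 + \<rho>0) - bvn_copula (1/2) (1/2) \<rho>0"
      if "\<rho> \<in> {0<..1}" "u \<in> {0..1/2}" for \<rho> u :: real
      using that by (rule error)
  qed (use bvn_copula_bounds tight half \<rho>0 bvn_upper_error_at_half[of \<rho>0]
      rho0_numerics[folded \<rho>0_def] in \<open>auto simp: less_imp_le\<close>)
qed

end
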